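(* Let $k$ be a field of characteristic zero and let $q,r\geq 2$ be integers with $\gcd(q,r)=1$. For every integer $m\geq 0$, every $(m+1)$-tuple $\underline{n}=(n_0,\ldots,n_m)$ of integers $n_i>1$ and every polynomial $p\in k[u]$ with $p(0)\neq 0$, the Makar-Limanov and Derksen invariants of the $k$-algebra $R_m(\underline{n},p)^{[1]}$ are respectively equal to the subalgebras $$\mathrm{ML}(R_m(\underline{n},p)^{[1]})=k \quad \textrm{and} \quad \mathrm{DK}(R_m(\underline{n},p)^{[1]})=R_m(\underline{n},p)^{[1]}.$$
   Context: Set $\underline{x}^{\underline{n}}=\prod_{i=0}^{m}x_{i}^{n_{i}}$, $\underline{x}=\prod_{i=0}^m x_i$, and $$R_m(\underline{n},p)=k[x_0,\ldots,x_m,y,z,t]/\left(\underline{x}^{\underline{n}}y +z^q+t^r+x_0p(\underline{x})\right).$$ For a ring $R$, $R^{[1]}$ denotes a polynomial ring in one variable over $R$. For a $k$-algebra $B$, a $k$-derivation $\partial$ of $B$ is locally nilpotent if for every $b\in B$ there is $N\geq 1$ with $\partial^N(b)=0$. The Makar-Limanov invariant $\mathrm{ML}(B)$ is the intersection of the kernels of all locally nilpotent $k$-derivations of $B$; the Derksen invariant $\mathrm{DK}(B)$ is the $k$-subalgebra of $B$ generated by the kernels of all nonzero locally nilpotent $k$-derivations of $B$. *)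

theory Defs
  imports
    "HOL-Library.Poly_Mapping"
    "HOL-Computational_Algebra.Polynomial"
    "HOL-Algebra.QuotRing"
    "HOL-Algebra.Generated_Rings"
    "HOL-Algebra.UnivPoly"
begin

section \<open>Locally nilpotent derivations\<close>

text \<open>A \<open>k\<close>-algebra is a HOL-Algebra ring \<open>B\<close> together with its structure map \<open>\<phi>\<close> from
  the field \<open>k\<close> (a type) to \<open>B\<close>. Maps \<open>B \<rightarrow> B\<close> are HOL functions of which
  only the values on \<open>carrier B\<close> matter.\<close>

definition derivation_over :: "('k \<Rightarrow> 'b) \<Rightarrow> ('b, 'c) ring_scheme \<Rightarrow> ('b \<Rightarrow> 'b) \<Rightarrow> bool" where
  "derivation_over \<phi> B D \<longleftrightarrow>
     D \<in> carrier B \<rightarrow> carrier B \<and>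
     (\<forall>a\<in>carrier B. \<forall>b\<in>carrier B. D (a \<oplus>\<^bsub>B\<^esub> b) = D a \<oplus>\<^bsub>B\<^esub> D b) \<and>
     (\<forall>c. \<forall>b\<in>carrier B. D (\<phi> c \<otimes>\<^bsub>B\<^esub> b) = \<phi> c \<otimes>\<^bsub>B\<^esub> D b) \<and>
     (\<forall>a\<in>carrier B. \<forall>b\<in>carrier B.
        D (a \<otimes>\<^bsub>B\<^esub> b) = (D a \<otimes>\<^bsub>B\<^esub> b) \<oplus>\<^bsub>B\<^esub> (a \<otimes>\<^bsub>B\<^esub> D b))"

definition locally_nilpotent_derivation ::
    "('k \<Rightarrow> 'b) \<Rightarrow> ('b, 'c) ring_scheme \<Rightarrow> ('b \<Rightarrow> 'b) \<Rightarrow> bool" where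
  "locally_nilpotent_derivation \<phi> B D \<longleftrightarrow>
     derivation_over \<phi> B D \<and>
     (\<forall>b\<in>carrier B. \<exists>N\<ge>1. (D ^^ N) b = \<zero>\<^bsub>B\<^esub>)"

definition makar_limanov :: "('k \<Rightarrow> 'b) \<Rightarrow> ('b, 'c) ring_scheme \<Rightarrow> 'b set" where
  "makar_limanov \<phi> B = (\<Inter>D \<in> {D. locally_nilpotent_derivation \<phi> B D}. a_kernel B B D)"

text \<open>The \<open>k\<close>-subalgebra generated by a set is the subring generated by that set and
  the image of \<open>k\<close>; the latter matters only if there is no nonzero locally nilpotent derivation.\<close>

definition derksen :: "('k \<Rightarrow> 'b) \<Rightarrow> ('b, 'c) ring_scheme \<Rightarrow> 'b set" where
  "derksen \<phi> B = generate_ring B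
     (\<phi> ` UNIV \<union>
      (\<Union>D \<in> {D. locally_nilpotent_derivation \<phi> B D \<and> (\<exists>b\<in>carrier B. D b \<noteq> \<zero>\<^bsub>B\<^esub>)}.
         a_kernel B B D))"


section \<open>Multivariate polynomial rings\<close>

text \<open>With coefficients in \<open>'k\<close> and variables in \<open>'v\<close>, represented by finitely supported
  functions from monomials (exponent vectors) to coefficients, with the convolution product.\<close>

type_synonym ('v, 'k) mpoly = "('v \<Rightarrow>\<^sub>0 nat) \<Rightarrow>\<^sub>0 'k"

definition mpoly_const :: "'k::zero \<Rightarrow> ('v, 'k) mpoly" where
  "mpoly_const c = Poly_Mapping.single 0 c"

definition mpoly_var :: "'v \<Rightarrow> ('v, 'k::zero_neq_one) mpoly" where
  "mpoly_var v = Poly_Mapping.single (Poly_Mapping.single v 1) 1"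

definition mpoly_ring :: "'v set \<Rightarrow> ('v, 'k::comm_ring_1) mpoly ring" where
  "mpoly_ring V =
     \<lparr>carrier = {f. \<forall>\<mu>\<in>Poly_Mapping.keys f. Poly_Mapping.keys \<mu> \<subseteq> V},
      mult = (*), one = 1, zero = 0, add = (+)\<rparr>"


section \<open>The rings \<open>R\<^sub>m(n, p)\<close> and their cylinders\<close>

datatype var = X nat | Y | Z | T

definition R_poly_ring :: "nat \<Rightarrow> (var, 'k::field) mpoly ring" where
  "R_poly_ring m = mpoly_ring (X ` {..m} \<union> {Y, Z, T})"

definition R_relation ::
    "nat \<Rightarrow> nat \<Rightarrow> nat \<Rightarrow> (nat \<Rightarrow> nat) \<Rightarrow> 'k::field poly \<Rightarrow> (var, 'k) mpoly" where
  "R_relation q r m n p =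
     (\<Prod>i\<le>m. mpoly_var (X i) ^ n i) * mpoly_var Y + mpoly_var Z ^ q + mpoly_var T ^ r
     + mpoly_var (X 0) * poly (map_poly mpoly_const p) (\<Prod>i\<le>m. mpoly_var (X i))"

definition R_ideal ::
    "nat \<Rightarrow> nat \<Rightarrow> nat \<Rightarrow> (nat \<Rightarrow> nat) \<Rightarrow> 'k::field poly \<Rightarrow> (var, 'k) mpoly set" where
  "R_ideal q r m n p = PIdl\<^bsub>R_poly_ring m\<^esub> (R_relation q r m n p)"

definition R_ring ::
    "nat \<Rightarrow> nat \<Rightarrow> nat \<Rightarrow> (nat \<Rightarrow> nat) \<Rightarrow> 'k::field poly \<Rightarrow> (var, 'k) mpoly set ring" where
  "R_ring q r m n p = R_poly_ring m Quot R_ideal q r m n p"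

definition R_scalar ::
    "nat \<Rightarrow> nat \<Rightarrow> nat \<Rightarrow> (nat \<Rightarrow> nat) \<Rightarrow> 'k::field poly \<Rightarrow> 'k \<Rightarrow> (var, 'k) mpoly set" where
  "R_scalar q r m n p c = R_ideal q r m n p +>\<^bsub>R_poly_ring m\<^esub> mpoly_const c"

text \<open>The polynomial ring in one variable over \<open>R_ring q r m n p\<close> is \<open>UP (R_ring q r m n p)\<close>;
  its structure map sends a scalar to a constant polynomial.\<close>

definition R_cylinder_scalar ::
    "nat \<Rightarrow> nat \<Rightarrow> nat \<Rightarrow> (nat \<Rightarrow> nat) \<Rightarrow> 'k::field poly \<Rightarrow> 'k \<Rightarrow> (nat \<Rightarrow> (var, 'k) mpoly set)" where
  "R_cylinder_scalar q r m n p c =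
     up_ring.monom (UP (R_ring q r m n p)) (R_scalar q r m n p c) 0"

end

theory Submission
  imports Defs "HOL-Computational_Algebra.Fraction_Field"
begin

text \<open>Write \<open>B = R\<^sub>m(n, p)[w]\<close> and \<open>M\<close> for the product of the \<open>x\<^sub>i\<^bsup>n\<^sub>i\<^esup>\<close>. The derivation \<open>\<partial>\<^sub>w\<close> kills \<open>R\<^sub>m(n, p)\<close>, and the
  derivation \<open>M \<partial>\<^sub>z - q z\<^bsup>q-1\<^esup> \<partial>\<^sub>y\<close> kills \<open>w\<close>; hence the Derksen invariant is everything. An element killed by these
  two and by \<open>M \<partial>\<^sub>t - r t\<^bsup>r-1\<^esup> \<partial>\<^sub>y\<close> is a Laurent polynomial in the \<open>x\<^sub>i\<close> alone, so it remains to find, for each \<open>i\<close>,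
  a locally nilpotent derivation of \<open>B\<close> that moves \<open>x\<^sub>i\<close> and no other \<open>x\<^sub>j\<close>.

  This is Danielewski's fibre product trick. For \<open>x = x\<^sub>i\<close>, the relation reads
  \<open>u x\<^sup>n y + z\<^sup>q + a + x b = 0\<close> with \<open>u\<close> and \<open>a\<close> free of \<open>x\<close>, \<open>y\<close>, \<open>z\<close>. Once \<open>u\<close> and \<open>a\<close> are inverted, \<open>z\<^sup>q + a\<close> is
  separable in \<open>z\<close>, so the cylinder over this hypersurface is isomorphic to the one over \<open>x v + z\<^sup>q + a = 0\<close>, which
  carries the derivation \<open>v \<partial>\<^sub>z - q z\<^bsup>q-1\<^esup> \<partial>\<^sub>x\<close>. Since \<open>u\<close> and \<open>a\<close> lie in its kernel, multiplying by a power of \<open>a u\<close>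
  clears denominators.

  All computations take place in the field of rational functions in the \<open>x\<^sub>i\<close>, \<open>z\<close>, \<open>t\<close>, \<open>w\<close>, which contains \<open>B\<close>.\<close>

section \<open>Derivations and subrings of a field\<close>

definition is_derivation :: "('a::comm_ring_1 \<Rightarrow> 'a) \<Rightarrow> bool" where
  "is_derivation D \<longleftrightarrow>
     (\<forall>a b. D (a + b) = D a + D b) \<and> (\<forall>a b. D (a * b) = D a * b + a * D b)"

lemma derivation_add: "is_derivation D \<Longrightarrow> D (a + b) = D a + D b"
  and derivation_mult: "is_derivation D \<Longrightarrow> D (a * b) = D a * b + a * D b"
  by (auto simp: is_derivation_def)

lemma derivation_0 [simp]: "is_derivation D \<Longrightarrow> D 0 = 0"
  using derivation_add[of D 0 0] by simp

lemma derivation_1 [simp]: "is_derivation D \<Longrightarrow> D 1 = 0"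
  using derivation_mult[of D 1 1] by simp

lemma derivation_minus: "is_derivation D \<Longrightarrow> D (- a) = - D a"
  using derivation_add[of D a "- a"] by (simp add: eq_neg_iff_add_eq_0 add.commute)

lemma derivation_power:
  "is_derivation D \<Longrightarrow> D (a ^ k) = of_nat k * a ^ (k - 1) * D a"
proof (induction k)
  case (Suc k)
  then show ?case by (cases k) (simp_all add: derivation_mult algebra_simps)
qed simp

lemma derivation_sum: "is_derivation D \<Longrightarrow> D (sum f A) = (\<Sum>i\<in>A. D (f i))"
  by (induction A rule: infinite_finite_induct) (simp_all add: derivation_add)

lemma derivation_inverse:
  fixes a :: "'a::field"
  assumes "is_derivation D"
  shows "D (inverse a) = - D a / a ^ 2"
proof (cases "a = 0")
  case False
  then have "0 = D (a * inverse a)" using assms by simp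
  also have "\<dots> = D a * inverse a + a * D (inverse a)" using assms by (rule derivation_mult)
  finally show ?thesis using False by (simp add: field_simps power2_eq_square eq_neg_iff_add_eq_0)
qed (use assms in simp)

lemma is_derivation_scale: "is_derivation D \<Longrightarrow> is_derivation (\<lambda>f. c * D f)"
  by (simp add: is_derivation_def algebra_simps)

lemma is_derivation_plus:
  "is_derivation D \<Longrightarrow> is_derivation D' \<Longrightarrow> is_derivation (\<lambda>f. D f + D' f)"
  by (simp add: is_derivation_def algebra_simps)

text \<open>Subrings are plain sets inside a ring type, so that algebraic simplification applies to
  their elements and only membership is tracked.\<close>

locale type_subring =
  fixes A :: "'a::comm_ring_1 set"
  assumes one_mem [simp]: "1 \<in> A"
    and add_mem: "a \<in> A \<Longrightarrow> b \<in> A \<Longrightarrow> a + b \<in> A"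
    and uminus_mem: "a \<in> A \<Longrightarrow> - a \<in> A"
    and mult_mem: "a \<in> A \<Longrightarrow> b \<in> A \<Longrightarrow> a * b \<in> A"
begin

lemma zero_mem [simp]: "0 \<in> A"
  using add_mem[OF one_mem uminus_mem[OF one_mem]] by simp

lemma diff_mem: "a \<in> A \<Longrightarrow> b \<in> A \<Longrightarrow> a - b \<in> A"
  using add_mem[of a "- b"] uminus_mem[of b] by simp

lemma power_mem: "a \<in> A \<Longrightarrow> a ^ k \<in> A"
  by (induction k) (auto intro: mult_mem)

lemma of_nat_mem [simp]: "of_nat k \<in> A"
  by (induction k) (auto intro: add_mem)

lemma sum_mem: "(\<And>i. i \<in> I \<Longrightarrow> f i \<in> A) \<Longrightarrow> sum f I \<in> A"
  by (induction I rule: infinite_finite_induct) (auto intro: add_mem)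

lemma prod_mem: "(\<And>i. i \<in> I \<Longrightarrow> f i \<in> A) \<Longrightarrow> prod f I \<in> A"
  by (induction I rule: infinite_finite_induct) (auto intro: mult_mem)

lemmas mems = add_mem uminus_mem mult_mem diff_mem power_mem

text \<open>First-order Taylor expansion; the Hensel arguments need the error term as
  \<open>b ^ 2\<close> times an element of the ring.\<close>

lemma binomial_mem:
  assumes "a \<in> A" "b \<in> A"
  shows "\<exists>r\<in>A. (a + b) ^ q = a ^ q + of_nat q * a ^ (q - 1) * b + b ^ 2 * r"
proof (induction q)
  case 0
  then show ?case by (intro bexI[of _ 0]) simp_all
next
  case (Suc q)
  then obtain r where r: "r \<in> A" "(a + b) ^ q = a ^ q + of_nat q * a ^ (q - 1) * b + b ^ 2 * r"
    by blast
  have q: "of_nat q * (a * a ^ (q - 1)) = of_nat q * a ^ q"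
    by (cases q) simp_all
  have "(a + b) ^ Suc q = (a + b) * (a ^ q + of_nat q * a ^ (q - 1) * b + b ^ 2 * r)"
    using r(2) by simp
  also have "\<dots> = a ^ Suc q + (of_nat q * (a * a ^ (q - 1)) + a ^ q) * b
      + b ^ 2 * (a * r + of_nat q * a ^ (q - 1) + b * r)"
    by (simp add: algebra_simps power2_eq_square)
  also have "\<dots> = a ^ Suc q + of_nat (Suc q) * a ^ (Suc q - 1) * b
      + b ^ 2 * (a * r + of_nat q * a ^ (q - 1) + b * r)"
    unfolding q by (simp add: algebra_simps)
  finally show ?case using r(1) assms
    by (intro bexI[of _ "a * r + of_nat q * a ^ (q - 1) + b * r"]) (auto intro!: mems)
qed

end

text \<open>Scalars are not built in; where a \<open>k\<close>-algebra is meant, they are listed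
  among the generators.\<close>

inductive_set adjoin :: "'a::comm_ring_1 set \<Rightarrow> 'a set" for S where
  gen: "a \<in> S \<Longrightarrow> a \<in> adjoin S"
| one: "1 \<in> adjoin S"
| add: "a \<in> adjoin S \<Longrightarrow> b \<in> adjoin S \<Longrightarrow> a + b \<in> adjoin S"
| uminus: "a \<in> adjoin S \<Longrightarrow> - a \<in> adjoin S"
| mult: "a \<in> adjoin S \<Longrightarrow> b \<in> adjoin S \<Longrightarrow> a * b \<in> adjoin S"

interpretation adjoin: type_subring "adjoin S" for S
  by standard (auto intro: adjoin.intros)

lemma (in type_subring) adjoin_subset:
  assumes "S \<subseteq> A"
  shows "adjoin S \<subseteq> A"
proof
  fix a assume "a \<in> adjoin S"
  then show "a \<in> A" using assms by induction (auto intro: mems)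
qed

lemma adjoin_mono: "S \<subseteq> S' \<Longrightarrow> adjoin S \<subseteq> adjoin S'"
  by (rule adjoin.adjoin_subset) (auto intro: adjoin.gen)

lemma derivation_adjoin_mem:
  assumes D: "is_derivation D" and A: "type_subring A"
    and S: "S \<subseteq> A" "\<And>a. a \<in> S \<Longrightarrow> D a \<in> A" and "a \<in> adjoin S"
  shows "D a \<in> A"
proof -
  interpret type_subring A by (fact A)
  from adjoin_subset[OF S(1)] have sub: "\<And>a. a \<in> adjoin S \<Longrightarrow> a \<in> A" by blast
  from \<open>a \<in> adjoin S\<close> show ?thesis
    by induction (use D S sub in \<open>auto simp: derivation_add derivation_mult derivation_minus intro!: mems\<close>)
qed

lemma derivation_adjoin_zero:
  assumes "is_derivation D" "\<And>a. a \<in> S \<Longrightarrow> D a = 0" "a \<in> adjoin S"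
  shows "D a = 0"
  using assms(3)
  by induction (use assms in \<open>auto simp: derivation_add derivation_mult derivation_minus\<close>)

section \<open>Local nilpotency at an element\<close>

definition nilpotent_at :: "('a::comm_ring_1 \<Rightarrow> 'a) \<Rightarrow> 'a \<Rightarrow> bool" where
  "nilpotent_at D f \<longleftrightarrow> (\<exists>N. (D ^^ N) f = 0)"

lemma nilpotent_at_step: "nilpotent_at D (D f) \<Longrightarrow> nilpotent_at D f"
  unfolding nilpotent_at_def by (metis funpow_Suc_right o_apply)

lemma nilpotent_at_0: "nilpotent_at D 0"
  unfolding nilpotent_at_def by (intro exI[of _ 0]) simp

lemma funpow_derivation:
  assumes "is_derivation D"
  shows "(D ^^ N) (a + b) = (D ^^ N) a + (D ^^ N) b" "(D ^^ N) (- a) = - (D ^^ N) a" "(D ^^ N) 0 = 0"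
  by (induction N) (use assms in \<open>simp_all add: derivation_add derivation_minus\<close>)

lemma funpow_eq_0_mono:
  assumes "is_derivation D" "(D ^^ N) f = 0" "N \<le> M"
  shows "(D ^^ M) f = 0"
proof -
  have "(D ^^ (M - N + N)) f = 0"
    unfolding funpow_add using assms by (simp add: funpow_derivation)
  then show ?thesis using assms by simp
qed

lemma nilpotent_at_add:
  assumes "is_derivation D" "nilpotent_at D f" "nilpotent_at D g"
  shows "nilpotent_at D (f + g)"
proof -
  obtain M N where "(D ^^ M) f = 0" "(D ^^ N) g = 0"
    using assms by (auto simp: nilpotent_at_def)
  then have "(D ^^ max M N) (f + g) = 0"
    using assms funpow_eq_0_mono[of D M f "max M N"] funpow_eq_0_mono[of D N g "max M N"]
    by (simp add: funpow_derivation)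
  then show ?thesis by (auto simp: nilpotent_at_def)
qed

text \<open>By Leibniz, \<open>D (f * g)\<close> is a sum of two products, in each of which one
  factor needs one application of \<open>D\<close> fewer; induction on the total number of
  applications avoids the binomial formula for iterates.\<close>

lemma nilpotent_at_mult:
  assumes D: "is_derivation D" and "nilpotent_at D f" "nilpotent_at D g"
  shows "nilpotent_at D (f * g)"
proof -
  have "nilpotent_at D (f * g)" if "(D ^^ M) f = 0" "(D ^^ N) g = 0" for M N f g
    using that
  proof (induction "M + N" arbitrary: M N f g rule: less_induct)
    case less
    show ?case
    proof (cases "M = 0 \<or> N = 0")
      case True
      then show ?thesis using less.prems by (auto simp: nilpotent_at_0)
    next
      case False
      then obtain M' N' where MN: "M = Suc M'" "N = Suc N'" by (metis not0_implies_Suc)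
      have "nilpotent_at D (D f * g)"
        using less.prems by (intro less.hyps[of M' N]) (auto simp: MN funpow_swap1)
      moreover have "nilpotent_at D (f * D g)"
        using less.prems by (intro less.hyps[of M N']) (auto simp: MN funpow_swap1)
      ultimately show ?thesis
        by (simp add: D derivation_mult nilpotent_at_add nilpotent_at_step)
    qed
  qed
  then show ?thesis using assms by (auto simp: nilpotent_at_def)
qed

text \<open>Hence local nilpotency only has to be tested on generators.\<close>

lemma nilpotent_at_subring:
  assumes "is_derivation D"
  shows "type_subring {f. nilpotent_at D f}"
proof
  show "1 \<in> {f. nilpotent_at D f}"
    using nilpotent_at_step[of D 1] assms by (simp add: nilpotent_at_0)
  show "- a \<in> {f. nilpotent_at D f}" if "a \<in> {f. nilpotent_at D f}" for a
    using that assms by (auto simp: nilpotent_at_def funpow_derivation)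
qed (use assms in \<open>auto intro: nilpotent_at_add nilpotent_at_mult\<close>)

text \<open>Factors killed by \<open>D\<close> pass through it, so the \<open>N\<close>-th iterate
  of \<open>c D\<close> at \<open>f\<close> is \<open>c ^ N\<close> times that of \<open>D\<close>.
  This permits clearing denominators that lie in the kernel.\<close>

lemma nilpotent_at_scale:
  assumes "is_derivation D" "D c = 0" "nilpotent_at D f"
  shows "nilpotent_at (\<lambda>f. c * D f) f"
proof -
  have "((\<lambda>f. c * D f) ^^ N) f = c ^ N * (D ^^ N) f" for N
    by (induction N) (use assms in \<open>simp_all add: derivation_mult derivation_power algebra_simps\<close>)
  then show ?thesis using assms(3) unfolding nilpotent_at_def by (metis mult_zero_right)
qed

section \<open>A Hensel lift and a derivation moving \<open>x\<close>\<close>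

text \<open>Newton's iteration. The start \<open>z\<close> is a root modulo \<open>x\<close> by
  \<open>eq\<close>, and the derivative \<open>q * \<zeta> ^ (q - 1)\<close> is invertible modulo
  \<open>x\<close> because \<open>\<zeta> ^ q\<close> is congruent to the unit
  \<open>- a\<close>.\<close>

lemma hensel_root:
  fixes x z a v b :: "'a::field"
  assumes "type_subring C" and mem: "x \<in> C" "z \<in> C" "a \<in> C" "inverse a \<in> C" "v \<in> C" "b \<in> C"
      "inverse (of_nat q) \<in> C"
    and nz: "a \<noteq> 0" "of_nat q \<noteq> (0::'a)" and eq: "z ^ q + a = - (x * v)"
  shows "\<exists>\<zeta>\<in>C. \<exists>h\<in>C. \<exists>e\<in>C. \<zeta> = z + x * h \<and> \<zeta> ^ q + a + x * b = x ^ Suc k * e"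
proof -
  interpret type_subring C by fact
  have q: "q > 0" using nz by (intro gr0I) auto
  show ?thesis
  proof (induction k)
    case 0
    show ?case
      by (intro bexI[of _ z] bexI[of _ 0] bexI[of _ "b - v"])
        (use mem eq in \<open>auto intro!: mems simp: algebra_simps\<close>)
  next
    case (Suc k)
    then obtain \<zeta> h e where C: "\<zeta> \<in> C" "h \<in> C" "e \<in> C"
      and z: "\<zeta> = z + x * h" and e: "\<zeta> ^ q + a + x * b = x ^ Suc k * e" by blast
    \<comment> \<open>Newton's correction: modulo \<open>x\<close> the inverse of
      \<open>q * \<zeta> ^ (q - 1)\<close> is \<open>- \<zeta> / (q * a)\<close>, so subtracting the
      error \<open>x ^ Suc k * e\<close> divided by the derivative means adding
      \<open>x ^ Suc k * d\<close>.\<close>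
    define d where "d = e * \<zeta> * inverse (of_nat q) * inverse a"
    have d: "d \<in> C" unfolding d_def by (intro mems C mem)
    have xk: "x ^ Suc k * d \<in> C" by (intro mems mem d)
    obtain r where r: "r \<in> C" "(\<zeta> + x ^ Suc k * d) ^ q =
        \<zeta> ^ q + of_nat q * \<zeta> ^ (q - 1) * (x ^ Suc k * d) + (x ^ Suc k * d) ^ 2 * r"
      using binomial_mem[OF C(1) xk] by blast
    define e' where "e' = inverse a * e * (x ^ k * e - b) + x ^ k * d ^ 2 * r"
    have "\<zeta> ^ (q - 1) * \<zeta> = \<zeta> ^ q" using q by (metis power_minus_mult)
    then have qd: "of_nat q * \<zeta> ^ (q - 1) * d = inverse a * e * \<zeta> ^ q"
      unfolding d_def using nz by (simp add: field_simps)
    have zq: "\<zeta> ^ q = x ^ Suc k * e - a - x * b" using e by (simp add: algebra_simps)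
    have "(\<zeta> + x ^ Suc k * d) ^ q + a + x * b =
        (\<zeta> ^ q + a + x * b) + x ^ Suc k * (of_nat q * \<zeta> ^ (q - 1) * d) + (x ^ Suc k * d) ^ 2 * r"
      unfolding r(2) by (simp add: algebra_simps)
    also have "\<dots> = x ^ Suc k * (e + inverse a * e * (x ^ Suc k * e - a - x * b))
        + (x ^ Suc k * d) ^ 2 * r"
      unfolding e qd zq by (simp add: algebra_simps)
    \<comment> \<open>The summand \<open>e\<close> cancels against \<open>inverse a * e * a\<close>;
      the rest has a factor \<open>x\<close>, which is the gain of one power.\<close>
    also have "e + inverse a * e * (x ^ Suc k * e - a - x * b) = x * (inverse a * e * (x ^ k * e - b))"
      using nz by (simp add: algebra_simps)
    also have "x ^ Suc k * (x * (inverse a * e * (x ^ k * e - b))) + (x ^ Suc k * d) ^ 2 * r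
        = x ^ Suc (Suc k) * e'"
      unfolding e'_def by (simp add: algebra_simps power2_eq_square)
    finally have "(\<zeta> + x ^ Suc k * d) ^ q + a + x * b = x ^ Suc (Suc k) * e'" .
    moreover have "\<zeta> + x ^ Suc k * d = z + x * (h + x ^ k * d)"
      unfolding z by (simp add: algebra_simps)
    moreover have "e' \<in> C" unfolding e'_def by (intro mems mem C d r)
    moreover have "\<zeta> + x ^ Suc k * d \<in> C" by (intro mems mem C d)
    moreover have "h + x ^ k * d \<in> C" by (intro mems mem C d)
    ultimately show ?case by blast
  qed
qed

text \<open>The difference \<open>z - \<zeta>\<close> times a unit modulo \<open>x\<close> equals
  \<open>z ^ q - \<zeta> ^ q\<close>, and a unit modulo \<open>x\<close> is a unit modulo
  \<open>x ^ n\<close>. This is the uniqueness half of Hensel's lemma.\<close>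

lemma hensel_unique:
  fixes x z \<zeta> a :: "'a::field"
  assumes "type_subring C" and mem: "x \<in> C" "z \<in> C" "\<zeta> \<in> C" "inverse a \<in> C"
      "inverse (of_nat q) \<in> C" "g \<in> C" "e \<in> C" "e' \<in> C"
    and nz: "a \<noteq> 0" "of_nat q \<noteq> (0::'a)"
    and eq: "\<zeta> = z + x * g" "z ^ q + a = x * e" "z ^ q - \<zeta> ^ q = x ^ n * e'"
  shows "\<exists>\<tau>\<in>C. z = \<zeta> + x ^ n * \<tau>"
proof -
  interpret type_subring C by fact
  have q: "q > 0" using nz by (intro gr0I) auto
  have "x * g \<in> C" by (intro mems mem)
  from binomial_mem[OF mem(2) this] obtain r where r: "r \<in> C"
    "\<zeta> ^ q = z ^ q + of_nat q * z ^ (q - 1) * (x * g) + (x * g) ^ 2 * r"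
    unfolding eq(1) by blast
  have "z ^ (q - 1) * z = z ^ q" using q by (metis power_minus_mult)
  then have zq: "z ^ (q - 1) * z = x * e - a" using eq(2) by (simp add: algebra_simps)
  define l where "l = z * inverse (of_nat q) * inverse a"
  define h where "h = - (e * inverse a) - g * r * l"
  have h: "h \<in> C" unfolding h_def l_def by (intro mems mem r)
  \<comment> \<open>The cofactor of \<open>z - \<zeta>\<close> in \<open>z ^ q - \<zeta> ^ q\<close> is a unit modulo \<open>x\<close>, with inverse \<open>- l\<close>.\<close>
  have "x ^ n * e' * (- l) = x * g * ((of_nat q * z ^ (q - 1) + x * g * r) * l)"
    unfolding eq(3)[symmetric] r(2) by (simp add: algebra_simps power2_eq_square)
  also have "of_nat q * z ^ (q - 1) * l = z ^ (q - 1) * z * inverse a"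
    unfolding l_def using nz by (simp add: field_simps)
  then have "(of_nat q * z ^ (q - 1) + x * g * r) * l = - 1 - x * h"
    unfolding h_def zq using nz by (simp add: algebra_simps)
  finally have main: "(z - \<zeta>) * (1 + x * h) = x ^ n * (- (e' * l))"
    unfolding eq(1) by (simp add: algebra_simps)
  \<comment> \<open>Truncated geometric series: it inverts \<open>1 + x * h\<close> up to a multiple
    of \<open>x ^ n\<close>.\<close>
  define w where "w = (\<Sum>j<n. (- (x * h)) ^ j)"
  have "w \<in> C" unfolding w_def by (intro sum_mem mems mem h)
  have geo: "(1 + x * h) * w = 1 - (- (x * h)) ^ n"
    unfolding w_def using one_diff_power_eq[of "- (x * h)" n] by simp
  have "z - \<zeta> = (z - \<zeta>) * (1 + x * h) * w + (z - \<zeta>) * (- (x * h)) ^ n"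
    unfolding mult.assoc geo by (simp add: algebra_simps)
  also have "(- (x * h)) ^ n = x ^ n * (- h) ^ n"
    by (simp flip: power_mult_distrib)
  finally have "z = \<zeta> + x ^ n * (- (e' * l) * w + (z - \<zeta>) * (- h) ^ n)"
    unfolding main by (simp add: algebra_simps)
  moreover have "- (e' * l) * w + (z - \<zeta>) * (- h) ^ n \<in> C"
    unfolding l_def by (intro mems mem h \<open>w \<in> C\<close>)
  ultimately show ?thesis by blast
qed

text \<open>In the locale below, \<open>s\<close> is the coordinate of the cylinder. The element \<open>z\<^sub>1 = z + x s\<close>
  takes part in the relation \<open>x v + z\<^sub>1\<^sup>q + a = 0\<close>, whose symmetry in \<open>x\<close> and \<open>v\<close> provides a derivation
  moving \<open>x\<close>. After inverting \<open>a\<close> and \<open>u\<close>, the whole ring is a polynomial ring in one variable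
  \<open>\<tau> = (z - \<zeta>) / x\<^sup>n\<close> over the ring generated by \<open>x\<close>, \<open>v\<close>, \<open>z\<^sub>1\<close>, where \<open>\<zeta>\<close> is the Hensel lift of \<open>z\<^sub>1\<close>
  to a root of \<open>\<zeta>\<^sup>q + a + x b\<close> modulo \<open>x\<^sup>n\<close>.\<close>

locale cylinder_chart =
  fixes K :: "'a::field set" and x y z s a u b :: 'a and q n :: nat
    and dx dz ds :: "'a \<Rightarrow> 'a"
  assumes dx: "is_derivation dx" "dx x = 1" "dx z = 0" "dx s = 0" "\<And>c. c \<in> K \<Longrightarrow> dx c = 0"
    and dz: "is_derivation dz" "dz x = 0" "dz z = 1" "dz s = 0" "\<And>c. c \<in> K \<Longrightarrow> dz c = 0"
    and ds: "is_derivation ds" "ds x = 0" "ds z = 0" "ds s = 1" "\<And>c. c \<in> K \<Longrightarrow> ds c = 0"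
    and coeffs: "a \<in> adjoin K" "u \<in> adjoin K" "b \<in> adjoin (insert x K)" "inverse (of_nat q) \<in> K"
    and nonzero: "a \<noteq> 0" "u \<noteq> 0" "x \<noteq> 0" "of_nat q \<noteq> (0::'a)"
    and n: "n \<ge> 1"
    and relation: "u * x ^ n * y + z ^ q + a + x * b = 0"
begin

definition "B = adjoin (K \<union> {x, y, z, s})"
definition "z1 = z + x * s"
definition "v = - (z1 ^ q + a) / x"
definition "C1 = adjoin (K \<union> {inverse a, inverse u, x, v, z1})"
text \<open>The localization of \<open>B\<close> at \<open>a * u\<close>, realized inside the
  field.\<close>

definition "C = {f. \<exists>N. (a * u) ^ N * f \<in> B}"

sublocale B: type_subring B unfolding B_def by (rule adjoin.type_subring_axioms)
sublocale C1: type_subring C1 unfolding C1_def by (rule adjoin.type_subring_axioms)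

lemma B_gens: "c \<in> K \<Longrightarrow> c \<in> B" "x \<in> B" "y \<in> B" "z \<in> B" "s \<in> B"
  unfolding B_def by (auto intro: adjoin.gen)

lemma C1_gens: "c \<in> K \<Longrightarrow> c \<in> C1" "inverse a \<in> C1" "inverse u \<in> C1" "x \<in> C1" "v \<in> C1" "z1 \<in> C1"
  unfolding C1_def by (auto intro: adjoin.gen)

lemma B_coeffs: "a \<in> B" "u \<in> B" "b \<in> B"
  using coeffs adjoin_mono[of K "K \<union> {x, y, z, s}"] adjoin_mono[of "insert x K" "K \<union> {x, y, z, s}"]
  unfolding B_def by blast+

lemma C1_coeffs: "a \<in> C1" "u \<in> C1" "b \<in> C1"
  using coeffs adjoin_mono[of K "K \<union> {inverse a, inverse u, x, v, z1}"]
    adjoin_mono[of "insert x K" "K \<union> {inverse a, inverse u, x, v, z1}"]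
  unfolding C1_def by blast+

lemma B_subset_C: "f \<in> B \<Longrightarrow> f \<in> C"
  unfolding C_def by (auto intro: exI[of _ 0])

sublocale C: type_subring C
proof
  fix f g assume "f \<in> C" "g \<in> C"
  then obtain M N where MN: "(a * u) ^ M * f \<in> B" "(a * u) ^ N * g \<in> B" by (auto simp: C_def)
  have "(a * u) ^ (M + N) * (f + g) = (a * u) ^ N * ((a * u) ^ M * f) + (a * u) ^ M * ((a * u) ^ N * g)"
    by (simp add: power_add algebra_simps)
  then have "(a * u) ^ (M + N) * (f + g) \<in> B" by (metis B.mems(1,3,5) MN B_coeffs(1,2))
  then show "f + g \<in> C" by (auto simp: C_def)
  have "(a * u) ^ (M + N) * (f * g) = ((a * u) ^ M * f) * ((a * u) ^ N * g)"
    by (simp add: power_add algebra_simps)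
  then have "(a * u) ^ (M + N) * (f * g) \<in> B" by (metis B.mult_mem MN)
  then show "f * g \<in> C" by (auto simp: C_def)
next
  fix f assume "f \<in> C"
  then show "- f \<in> C" by (auto simp: C_def dest: B.uminus_mem)
qed (simp add: B_subset_C)

lemma inverse_mem_C: "inverse a \<in> C" "inverse u \<in> C"
proof -
  have "(a * u) ^ 1 * inverse a = u" "(a * u) ^ 1 * inverse u = a" using nonzero by simp_all
  then show "inverse a \<in> C" "inverse u \<in> C" unfolding C_def using B_coeffs by (metis (mono_tags, lifting) mem_Collect_eq)+
qed

lemma relation_v: "z1 ^ q + a = - (x * v)"
  unfolding v_def using nonzero by simp

text \<open>The division by \<open>x\<close> in \<open>v\<close> is exact: expanding
  \<open>z1 ^ q\<close> around \<open>z\<close> and using the relation for \<open>z ^ q + a\<close>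
  leaves only multiples of \<open>x\<close>, the term with \<open>y\<close> because \<open>n\<close>
  is at least 1.\<close>

lemma v_mem_B: "v \<in> B"
proof -
  obtain r where r: "r \<in> B" "(z + x * s) ^ q = z ^ q + of_nat q * z ^ (q - 1) * (x * s) + (x * s) ^ 2 * r"
    using B.binomial_mem[of z "x * s" q] B.mult_mem B_gens by blast
  obtain k where k: "n = Suc k" using n by (cases n) auto
  have "x * v = (u * x ^ n * y + z ^ q + a + x * b) - (z1 ^ q + a)"
    unfolding relation relation_v by simp
  also have "\<dots> = x * (u * x ^ k * y + b - of_nat q * z ^ (q - 1) * s - x * s ^ 2 * r)"
    unfolding z1_def k r(2) by (simp add: algebra_simps power2_eq_square)
  finally have "x * v = x * (u * x ^ k * y + b - of_nat q * z ^ (q - 1) * s - x * s ^ 2 * r)" .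
  then have "v = u * x ^ k * y + b - of_nat q * z ^ (q - 1) * s - x * s ^ 2 * r" using nonzero by simp
  also have "\<dots> \<in> B" by (intro B.mems B.of_nat_mem B_gens B_coeffs r)
  finally show ?thesis .
qed

lemma z1_mem_B: "z1 \<in> B"
  unfolding z1_def by (intro B.mems B_gens(2,4,5))

lemma C1_subset_C: "C1 \<subseteq> C"
  unfolding C1_def using inverse_mem_C B_subset_C[OF v_mem_B] B_subset_C[OF z1_mem_B] B_subset_C[OF B_gens(2)]
  by (intro C.adjoin_subset) (auto intro!: B_subset_C B_gens(1))

text \<open>\<open>\<zeta>\<close> is the Hensel lift of \<open>z1\<close> over \<open>C1\<close>.
  By the relation, \<open>z\<close> is a root of the same polynomial modulo \<open>x ^ n\<close>,
  and it is congruent to \<open>z1\<close> modulo \<open>x\<close>. So uniqueness applies, in the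
  larger ring \<open>C\<close> that contains \<open>z\<close> and \<open>s\<close>.\<close>

lemma obtain_coordinate:
  obtains \<zeta> h e \<tau> where "\<zeta> \<in> C1" "h \<in> C1" "e \<in> C1" "\<tau> \<in> C" "\<zeta> = z1 + x * h"
    "\<zeta> ^ q + a + x * b = x ^ n * e" "z = \<zeta> + x ^ n * \<tau>"
proof -
  obtain k where k: "n = Suc k" using n by (cases n) auto
  obtain \<zeta> h e where *: "\<zeta> \<in> C1" "h \<in> C1" "e \<in> C1" "\<zeta> = z1 + x * h"
      "\<zeta> ^ q + a + x * b = x ^ n * e"
    using hensel_root[OF C1.type_subring_axioms C1_gens(4,6) C1_coeffs(1) C1_gens(2,5) C1_coeffs(3)
      C1_gens(1)[OF coeffs(4)] nonzero(1,4) relation_v, of k] unfolding k by blast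
  have C: "\<zeta> \<in> C" "h \<in> C" "e \<in> C" using * C1_subset_C by auto
  have "\<exists>\<tau>\<in>C. z = \<zeta> + x ^ n * \<tau>"
  \<comment> \<open>\<open>s + h\<close> comes from \<open>z1 = z + x * s\<close>. The value of
    \<open>e\<close> is the relation solved for \<open>z ^ q + a\<close> and divided by
    \<open>x\<close>; that of \<open>e'\<close> is the difference of the equations for
    \<open>z\<close> and \<open>\<zeta>\<close>, divided by \<open>x ^ n\<close>.\<close>
  proof (rule hensel_unique[where a = a and g = "s + h" and e = "- (u * x ^ k * y) - b" and e' = "- (u * y) - e"])
    show "x \<in> C" "z \<in> C" "inverse (of_nat q) \<in> C"
      by (auto intro!: B_subset_C B_gens coeffs)
    show "s + h \<in> C" by (intro C.mems B_subset_C B_gens C)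
    show "- (u * x ^ k * y) - b \<in> C" "- (u * y) - e \<in> C"
      by (intro C.mems C; intro B_subset_C B_gens B_coeffs)+
    show "\<zeta> = z + x * (s + h)" using * by (simp add: z1_def algebra_simps)
    have "z ^ q + a = (u * x ^ n * y + z ^ q + a + x * b) + x * (- (u * x ^ k * y) - b)"
      unfolding k by (simp add: algebra_simps)
    then show "z ^ q + a = x * (- (u * x ^ k * y) - b)"
      unfolding relation by simp
    have "z ^ q - \<zeta> ^ q = (u * x ^ n * y + z ^ q + a + x * b) - (\<zeta> ^ q + a + x * b) - u * x ^ n * y"
      by (simp add: algebra_simps)
    then show "z ^ q - \<zeta> ^ q = x ^ n * (- (u * y) - e)"
      unfolding relation *(5) by (simp add: algebra_simps)
  qed (use nonzero inverse_mem_C C C.type_subring_axioms in auto)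
  with * that show thesis by blast
qed

lemma scale_into_B:
  assumes "finite S" "S \<subseteq> C"
  obtains N where "\<And>f. f \<in> S \<Longrightarrow> (a * u) ^ N * f \<in> B"
proof -
  have "\<forall>f\<in>S. \<exists>N. (a * u) ^ N * f \<in> B" using assms by (auto simp: C_def)
  then obtain N where N: "\<And>f. f \<in> S \<Longrightarrow> (a * u) ^ N f * f \<in> B" by metis
  have "(a * u) ^ sum N S * f \<in> B" if "f \<in> S" for f
  proof -
    have "sum N S = N f + sum N (S - {f})" using assms that by (simp add: sum.remove)
    then have "(a * u) ^ sum N S * f = (a * u) ^ sum N (S - {f}) * ((a * u) ^ N f * f)"
      by (simp add: power_add algebra_simps)
    then show ?thesis by (metis B.mult_mem B.power_mem B_coeffs(1,2) N that)
  qed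
  with that show thesis by blast
qed

text \<open>On the ring generated by \<open>C1\<close> and \<open>\<tau>\<close>, let
  \<open>x\<close> go to \<open>- q * z1 ^ (q - 1)\<close>, \<open>z1\<close> to \<open>v\<close>,
  and \<open>v\<close>, \<open>\<tau>\<close> to 0. This respects
  \<open>x * v + z1 ^ q + a = 0\<close> and is triangular, hence locally nilpotent; a power of
  \<open>a * u\<close> brings it back to \<open>B\<close>. The last conclusion lets
  \<open>dx f = 0\<close> be read off from \<open>E f = 0\<close>.\<close>

theorem derivation_moving_x:
  assumes "z1 \<noteq> 0"
  obtains E where "is_derivation E" "\<And>c. c \<in> K \<Longrightarrow> E c = 0" "\<And>f. f \<in> B \<Longrightarrow> E f \<in> B"
    "\<And>f. f \<in> B \<Longrightarrow> nilpotent_at E f" "E x \<noteq> 0"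
    "\<And>f. dz f = 0 \<Longrightarrow> ds f = 0 \<Longrightarrow> E f = E x * dx f"
proof -
  obtain \<zeta> h e \<tau> where zeta: "\<zeta> \<in> C1" "h \<in> C1" "e \<in> C1" "\<tau> \<in> C" "\<zeta> = z1 + x * h"
    "\<zeta> ^ q + a + x * b = x ^ n * e" "z = \<zeta> + x ^ n * \<tau>" using obtain_coordinate .
  \<comment> \<open>These are the values of \<open>D\<close> at \<open>x\<close>, \<open>z\<close>,
    \<open>s\<close>. The requirement \<open>D z1 = v\<close> yields \<open>es\<close>;
    \<open>D \<tau> = 0\<close> together with \<open>z = \<zeta> + x ^ n * \<tau>\<close> yields
    \<open>ez\<close>, whose first two summands are \<open>D \<zeta>\<close>.\<close>
  define ex where "ex = - (of_nat q * z1 ^ (q - 1))"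
  define ez where "ez = ex * dx \<zeta> + (v - ex * s) / x * ds \<zeta> + of_nat n * x ^ (n - 1) * ex * \<tau>"
  define es where "es = (v - ez - ex * s) / x"
  define D where "D f = ex * dx f + (ez * dz f + es * ds f)" for f
  have D: "is_derivation D"
    unfolding D_def[abs_def] by (intro is_derivation_plus is_derivation_scale dx dz ds)
  have D_gens: "D x = ex" "D z = ez" "D s = es" "\<And>c. c \<in> K \<Longrightarrow> D c = 0"
    using dx dz ds by (simp_all add: D_def)
  have D_coeffs: "D a = 0" "D u = 0"
    by (rule derivation_adjoin_zero[OF D D_gens(4)]; use coeffs in blast)+
  have D_z1: "D z1 = v"
    unfolding z1_def using D nonzero by (simp add: derivation_add derivation_mult D_gens es_def field_simps)
  \<comment> \<open>Differentiating the relation between \<open>x\<close>, \<open>v\<close> and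
    \<open>z1\<close>: the choice of \<open>ex\<close> cancels the contribution of
    \<open>D z1 = v\<close>, which forces \<open>D v = 0\<close>.\<close>
  have "D (x * v) = - D (z1 ^ q + a)"
    using arg_cong[OF relation_v, of D] D by (simp add: derivation_minus)
  then have "ex * v + x * D v = - (of_nat q * z1 ^ (q - 1) * v)"
    using D by (simp add: derivation_mult derivation_add derivation_power D_coeffs D_z1 D_gens)
  then have D_v: "D v = 0" using nonzero by (simp add: ex_def)
  have D_inv: "D (inverse a) = 0" "D (inverse u) = 0"
    using D by (simp_all add: derivation_inverse D_coeffs)

  \<comment> \<open>\<open>z\<^sub>1\<close> and \<open>x\<close>, hence all of \<open>C1\<close>, are killed by \<open>\<partial>\<^sub>z - x\<^sup>-\<^sup>1 \<partial>\<^sub>s\<close>; so on \<open>C1\<close> the derivation \<open>D\<close> does not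
    depend on the choice of \<open>ez\<close>, which is made such that \<open>D \<tau> = 0\<close>.\<close>
  define W where "W f = dz f + (- inverse x) * ds f" for f
  have W: "is_derivation W"
    unfolding W_def[abs_def] by (intro is_derivation_plus is_derivation_scale dz ds)
  have W_gens: "W x = 0" "\<And>c. c \<in> K \<Longrightarrow> W c = 0"
    using dz ds by (simp_all add: W_def)
  have W_z1: "W z1 = 0"
    unfolding W_def z1_def using dz ds nonzero by (simp add: derivation_add derivation_mult)
  have W_coeffs: "W a = 0" "W u = 0"
    by (rule derivation_adjoin_zero[OF W W_gens(2)]; use coeffs in blast)+
  have "W (x * v) = - W (z1 ^ q + a)"
    using arg_cong[OF relation_v, of W] W by (simp add: derivation_minus)
  then have W_v: "W v = 0"
    using W nonzero by (simp add: derivation_mult derivation_add derivation_power W_coeffs W_z1 W_gens)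
  have "W \<zeta> = 0"
    by (rule derivation_adjoin_zero[OF W _ zeta(1)[unfolded C1_def]])
      (use W in \<open>auto simp: W_gens W_coeffs W_z1 W_v derivation_inverse\<close>)
  then have "D \<zeta> = ex * dx \<zeta> + (v - ex * s) / x * ds \<zeta>"
    unfolding D_def es_def W_def using nonzero by (simp add: field_simps)
  moreover have "ez = D \<zeta> + (of_nat n * x ^ (n - 1) * ex * \<tau> + x ^ n * D \<tau>)"
    using arg_cong[OF zeta(7), of D] D
    by (simp add: derivation_add derivation_mult derivation_power D_gens)
  ultimately have D_tau: "D \<tau> = 0"
    using nonzero by (simp add: ez_def)

  \<comment> \<open>On \<open>G\<close> the nilpotency of \<open>D\<close> is visible. The next
    steps recover \<open>z\<close>, \<open>s\<close> and \<open>y\<close> from \<open>G\<close>, so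
    that \<open>B\<close> lies in the ring generated by \<open>G\<close>.\<close>
  define G where "G = K \<union> {inverse a, inverse u, x, v, z1, \<tau>}"
  have C1_G: "C1 \<subseteq> adjoin G" unfolding C1_def G_def by (intro adjoin_mono) auto
  have G_C: "G \<subseteq> C"
    using C1_gens C1_subset_C zeta(4) unfolding G_def by auto
  have G: "x \<in> adjoin G" "\<tau> \<in> adjoin G" "z1 \<in> adjoin G" "inverse u \<in> adjoin G"
    unfolding G_def by (auto intro: adjoin.gen)
  have z_G: "z \<in> adjoin G"
    unfolding zeta(7) using zeta(1) C1_G by (intro adjoin.mems G) auto
  obtain k where k: "n = Suc k" using n by (cases n) auto
  have "x * s = z1 - z" unfolding z1_def by simp
  also have "\<dots> = (z1 + x * h - \<zeta>) + x * (- h - x ^ k * \<tau>)"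
    unfolding zeta(7) k by (simp add: algebra_simps)
  finally have "x * s = x * (- h - x ^ k * \<tau>)" unfolding zeta(5) by simp
  then have "s = - h - x ^ k * \<tau>" using nonzero by simp
  then have s_G: "s \<in> adjoin G"
    using zeta(2) C1_G by (auto intro!: adjoin.mems G)
  have xt: "x ^ n * \<tau> \<in> adjoin G" by (intro adjoin.mems G)
  \<comment> \<open>To recover \<open>y\<close>, expand \<open>z ^ q\<close> around
    \<open>\<zeta>\<close> in the relation: every term becomes divisible by \<open>x ^ n\<close>,
    and \<open>u\<close> has been inverted.\<close>
  obtain r where r: "r \<in> adjoin G"
    "z ^ q = \<zeta> ^ q + of_nat q * \<zeta> ^ (q - 1) * (x ^ n * \<tau>) + (x ^ n * \<tau>) ^ 2 * r"
    using adjoin.binomial_mem[of \<zeta> G, OF _ xt] zeta(1) C1_G unfolding zeta(7) by blast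
  have "u * x ^ n * y = (u * x ^ n * y + z ^ q + a + x * b) - (z ^ q + a + x * b)" by simp
  also have "\<dots> = - (\<zeta> ^ q + a + x * b) - of_nat q * \<zeta> ^ (q - 1) * (x ^ n * \<tau>) - (x ^ n * \<tau>) ^ 2 * r"
    by (simp only: relation) (simp add: r(2) algebra_simps)
  also have "\<dots> = x ^ n * (- e - of_nat q * \<zeta> ^ (q - 1) * \<tau> - x ^ n * \<tau> ^ 2 * r)"
    unfolding zeta(6) by (simp add: algebra_simps power2_eq_square)
  finally have "x ^ n * (u * y) = x ^ n * (- e - of_nat q * \<zeta> ^ (q - 1) * \<tau> - x ^ n * \<tau> ^ 2 * r)"
    by (simp add: ac_simps)
  then have "u * y = - e - of_nat q * \<zeta> ^ (q - 1) * \<tau> - x ^ n * \<tau> ^ 2 * r"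
    using nonzero by (simp only: mult_cancel_left) simp
  then have "inverse u * (u * y) = inverse u * (- e - of_nat q * \<zeta> ^ (q - 1) * \<tau> - x ^ n * \<tau> ^ 2 * r)"
    by (rule arg_cong)
  then have "y = inverse u * (- e - of_nat q * \<zeta> ^ (q - 1) * \<tau> - x ^ n * \<tau> ^ 2 * r)"
    using nonzero by (simp add: mult.assoc[symmetric])
  then have y_G: "y \<in> adjoin G"
    using zeta(1,3) C1_G r(1) by (auto intro!: adjoin.mems G adjoin.of_nat_mem)
  have B_G: "B \<subseteq> adjoin G"
    unfolding B_def using z_G y_G s_G G by (intro adjoin.adjoin_subset) (auto simp: G_def intro: adjoin.gen)

  have kill: "nilpotent_at D f" if "D f = 0" for f
    using nilpotent_at_step[of D f] that by (simp add: nilpotent_at_0)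
  interpret nil: type_subring "{f. nilpotent_at D f}" by (rule nilpotent_at_subring[OF D])
  \<comment> \<open>Triangular order: \<open>v\<close> is killed, \<open>z1\<close> goes to
    \<open>v\<close>, and \<open>x\<close> goes to a polynomial in \<open>z1\<close>.\<close>
  have nil_z1: "z1 \<in> {f. nilpotent_at D f}"
    using nilpotent_at_step[of D z1] kill[OF D_v] by (simp add: D_z1)
  have "ex \<in> {f. nilpotent_at D f}"
    unfolding ex_def by (intro nil.mems nil.of_nat_mem nil_z1)
  then have nil_x: "nilpotent_at D x"
    using nilpotent_at_step[of D x] by (simp add: D_gens)
  have "adjoin G \<subseteq> {f. nilpotent_at D f}"
    using nil_z1 nil_x unfolding G_def
    by (intro nil.adjoin_subset) (auto intro: kill simp: D_gens D_inv D_v D_tau)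
  then have nil_B: "nilpotent_at D f" if "f \<in> B" for f using that B_G by auto

  have D_C: "D f \<in> C" if "f \<in> adjoin G" for f
  proof (rule derivation_adjoin_mem[OF D C.type_subring_axioms G_C _ that])
    have *: "v \<in> C" "z1 \<in> C" using C1_gens C1_subset_C by auto
    fix g assume "g \<in> G"
    then show "D g \<in> C"
      unfolding G_def
      by (auto simp: D_gens D_inv D_v D_tau D_z1 ex_def intro!: * C.mems)
  qed
  \<comment> \<open>\<open>D\<close> maps \<open>B\<close> only into \<open>C\<close>; a power of
    \<open>a * u\<close>, which \<open>D\<close> kills, is a common denominator for the images of
    the four generators.\<close>
  have "{D x, D y, D z, D s} \<subseteq> C" using D_C G(1) y_G z_G s_G by auto
  then obtain N where N: "\<And>f. f \<in> {D x, D y, D z, D s} \<Longrightarrow> (a * u) ^ N * f \<in> B"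
    using scale_into_B by (metis finite.emptyI finite.insertI)
  define c where "c = (a * u) ^ N"
  have D_c: "D c = 0" unfolding c_def using D by (simp add: derivation_mult derivation_power D_coeffs)
  define E where "E f = c * D f" for f
  show thesis
  proof
    show E: "is_derivation E" unfolding E_def[abs_def] using D by (rule is_derivation_scale)
    show "E c = 0" if "c \<in> K" for c using that by (simp add: E_def D_gens)
    show "E f \<in> B" if "f \<in> B" for f
      using that unfolding B_def
      by (rule derivation_adjoin_mem[OF E adjoin.type_subring_axioms, rotated 2])
        (use N D_gens(4) in \<open>auto simp: E_def c_def B_def intro: adjoin.gen\<close>)
    show "nilpotent_at E f" if "f \<in> B" for f
      unfolding E_def[abs_def] using D D_c nil_B[OF that] by (rule nilpotent_at_scale)
    show "E x \<noteq> 0" using assms nonzero by (simp add: E_def c_def D_gens ex_def)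
    show "E f = E x * dx f" if "dz f = 0" "ds f = 0" for f
      using that unfolding E_def D_gens by (simp add: D_def)
  qed
qed

end

section \<open>Substitution and partial derivatives of multivariate polynomials\<close>

text \<open>An order on variables makes monomials linearly ordered, hence polynomial rings integral domains.\<close>

primrec var_rank :: "var \<Rightarrow> nat" where
  "var_rank (X i) = i + 3" | "var_rank Y = 0" | "var_rank Z = 1" | "var_rank T = 2"

lemma var_rank_inject: "var_rank v = var_rank w \<Longrightarrow> v = w"
  by (cases v; cases w) simp_all

instantiation var :: linorder
begin

definition "v \<le> w \<longleftrightarrow> var_rank v \<le> var_rank w"
definition "v < w \<longleftrightarrow> var_rank v < var_rank w"

instance
  by standard (auto simp: less_eq_var_def less_var_def intro: var_rank_inject)

end

lemma mpoly_eq_sum_single: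
  "f = (\<Sum>\<mu>\<in>Poly_Mapping.keys f. Poly_Mapping.single \<mu> (Poly_Mapping.lookup f \<mu>))"
  by (rule poly_mapping_eqI) (auto simp: lookup_sum lookup_single when_def in_keys_iff)

lemma single_eq_const_mult_vars:
  fixes c :: "'k::comm_ring_1"
  shows "Poly_Mapping.single \<mu> c =
    mpoly_const c * (\<Prod>v\<in>Poly_Mapping.keys \<mu>. mpoly_var v ^ Poly_Mapping.lookup \<mu> v)"
proof -
  have power: "(mpoly_var v :: ('v, 'k) mpoly) ^ j = Poly_Mapping.single (Poly_Mapping.single v j) 1" for v :: 'v and j
    by (induction j) (simp_all add: mpoly_var_def mult_single flip: single_add)
  have "(\<Prod>v\<in>A. mpoly_var v ^ Poly_Mapping.lookup \<mu> v) =
      Poly_Mapping.single (\<Sum>v\<in>A. Poly_Mapping.single v (Poly_Mapping.lookup \<mu> v)) (1::'k)"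
    if "finite A" for A
    using that by induction (simp_all add: power mult_single)
  then show ?thesis
    by (simp add: mpoly_eq_sum_single[of \<mu>, symmetric] mpoly_const_def mult_single)
qed

lemma mpoly_ring_subring: "type_subring (carrier (mpoly_ring V))"
proof
  fix f g :: "('a, 'b) mpoly" assume fg: "f \<in> carrier (mpoly_ring V)" "g \<in> carrier (mpoly_ring V)"
  then show "f + g \<in> carrier (mpoly_ring V)"
    using keys_add[of f g] by (auto simp: mpoly_ring_def)
  have "Poly_Mapping.keys (\<mu> + \<nu>) \<subseteq> V"
    if "\<mu> \<in> Poly_Mapping.keys f" "\<nu> \<in> Poly_Mapping.keys g" for \<mu> \<nu>
    using keys_add[of \<mu> \<nu>] that fg by (auto simp: mpoly_ring_def)
  then show "f * g \<in> carrier (mpoly_ring V)"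
    using keys_mult[of f g] by (fastforce simp: mpoly_ring_def)
next
  fix f :: "('a, 'b) mpoly" assume "f \<in> carrier (mpoly_ring V)"
  then show "- f \<in> carrier (mpoly_ring V)"
    by (auto simp: mpoly_ring_def in_keys_iff)
qed (simp add: mpoly_ring_def)

lemma const_mem_mpoly_ring [simp]: "mpoly_const c \<in> carrier (mpoly_ring V)"
  by (simp add: mpoly_ring_def mpoly_const_def)

lemma var_mem_mpoly_ring: "v \<in> V \<Longrightarrow> mpoly_var v \<in> carrier (mpoly_ring V)"
  by (simp add: mpoly_ring_def mpoly_var_def)

lemma mpoly_ring_induct [consumes 1, case_names const var add mult]:
  fixes f :: "('v, 'k::comm_ring_1) mpoly"
  assumes "f \<in> carrier (mpoly_ring V)"
    and const: "\<And>c. P (mpoly_const c)"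
    and var: "\<And>v. v \<in> V \<Longrightarrow> P (mpoly_var v)"
    and add: "\<And>f g. P f \<Longrightarrow> P g \<Longrightarrow> P (f + g)"
    and mult: "\<And>f g. P f \<Longrightarrow> P g \<Longrightarrow> P (f * g)"
  shows "P f"
proof -
  have 0: "P 0" "P 1"
    using const[of 0] const[of 1] by (simp_all add: mpoly_const_def)
  have pow: "P (g ^ j)" if "P g" for g j
    using that by (induction j) (auto intro: 0 mult)
  have single: "P (Poly_Mapping.single \<mu> c)" if "Poly_Mapping.keys \<mu> \<subseteq> V" for \<mu> c
  proof -
    have "P (\<Prod>v\<in>A. mpoly_var v ^ Poly_Mapping.lookup \<mu> v)" if "A \<subseteq> V" for A
      using that by (induction A rule: infinite_finite_induct) (auto intro!: 0 mult pow var)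
    with that show ?thesis
      unfolding single_eq_const_mult_vars by (intro mult const)
  qed
  have "P (\<Sum>\<mu>\<in>A. Poly_Mapping.single \<mu> (Poly_Mapping.lookup f \<mu>))" if "A \<subseteq> Poly_Mapping.keys f" for A
    using that assms(1)
    by (induction A rule: infinite_finite_induct) (auto intro!: 0 add single simp: mpoly_ring_def)
  then show ?thesis by (subst mpoly_eq_sum_single) simp
qed

lemma mpoly_ring_UNIV: "f \<in> carrier (mpoly_ring UNIV)"
  by (simp add: mpoly_ring_def)

text \<open>Serves for two coefficient maps: constants into polynomials (\<open>mpoly.subst\<close>)
  and scalars into rational functions (\<open>scal.subst\<close>).\<close>

locale scalar_hom =
  fixes \<phi> :: "'k::comm_ring_1 \<Rightarrow> 'a::comm_ring_1"
  assumes hom_one: "\<phi> 1 = 1"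
    and hom_add: "\<phi> (c + d) = \<phi> c + \<phi> d"
    and hom_mult: "\<phi> (c * d) = \<phi> c * \<phi> d"
begin

lemma hom_zero: "\<phi> 0 = 0"
  using hom_add[of 0 0] by simp

definition subst_monom :: "('v \<Rightarrow> 'a) \<Rightarrow> ('v \<Rightarrow>\<^sub>0 nat) \<Rightarrow> 'a" where
  "subst_monom g \<mu> = (\<Prod>v\<in>Poly_Mapping.keys \<mu>. g v ^ Poly_Mapping.lookup \<mu> v)"

definition subst :: "('v \<Rightarrow> 'a) \<Rightarrow> ('v, 'k) mpoly \<Rightarrow> 'a" where
  "subst g f = (\<Sum>\<mu>\<in>Poly_Mapping.keys f. \<phi> (Poly_Mapping.lookup f \<mu>) * subst_monom g \<mu>)"

lemma subst_monom_superset: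
  "finite A \<Longrightarrow> Poly_Mapping.keys \<mu> \<subseteq> A \<Longrightarrow> subst_monom g \<mu> = (\<Prod>v\<in>A. g v ^ Poly_Mapping.lookup \<mu> v)"
  unfolding subst_monom_def by (rule prod.mono_neutral_left) (auto simp: in_keys_iff)

lemma subst_monom_add: "subst_monom g (\<mu> + \<nu>) = subst_monom g \<mu> * subst_monom g \<nu>"
proof -
  let ?A = "Poly_Mapping.keys \<mu> \<union> Poly_Mapping.keys \<nu>"
  show ?thesis
    using keys_add[of \<mu> \<nu>]
    by (simp add: subst_monom_superset[of ?A] lookup_add power_add prod.distrib)
qed

lemma subst_single: "subst g (Poly_Mapping.single \<mu> c) = \<phi> c * subst_monom g \<mu>"
  by (simp add: subst_def hom_zero)

lemma subst_add: "subst g (f + h) = subst g f + subst g h"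
  unfolding subst_def
  by (rule setsum_keys_plus_distrib[of "\<lambda>\<mu> c. \<phi> c * subst_monom g \<mu>"])
    (simp_all add: hom_zero hom_add algebra_simps)

lemma subst_0 [simp]: "subst g 0 = 0"
  by (simp add: subst_def)

lemma subst_sum: "subst g (sum f A) = (\<Sum>i\<in>A. subst g (f i))"
  by (induction A rule: infinite_finite_induct) (simp_all add: subst_add)

lemma subst_mult: "subst g (f * h) = subst g f * subst g h"
proof -
  let ?s = "\<lambda>f \<mu>. Poly_Mapping.single \<mu> (Poly_Mapping.lookup f \<mu>) :: ('b, 'k) mpoly"
  have "subst g (f * h) = subst g ((\<Sum>\<mu>\<in>Poly_Mapping.keys f. ?s f \<mu>) * (\<Sum>\<nu>\<in>Poly_Mapping.keys h. ?s h \<nu>))"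
    by (simp flip: mpoly_eq_sum_single)
  also have "\<dots> = (\<Sum>\<mu>\<in>Poly_Mapping.keys f. subst g (?s f \<mu>)) * (\<Sum>\<nu>\<in>Poly_Mapping.keys h. subst g (?s h \<nu>))"
    unfolding sum_product subst_sum
    by (intro sum.cong refl) (simp add: mult_single subst_single subst_monom_add hom_mult ac_simps)
  also have "\<dots> = subst g f * subst g h"
    unfolding subst_sum[symmetric] by (simp flip: mpoly_eq_sum_single)
  finally show ?thesis .
qed

lemma subst_const [simp]: "subst g (mpoly_const c) = \<phi> c"
  by (simp add: mpoly_const_def subst_single subst_monom_def)

lemma subst_var [simp]: "subst g (mpoly_var v) = g v"
  by (simp add: mpoly_var_def subst_single subst_monom_def hom_one)

lemma subst_1 [simp]: "subst g 1 = 1"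
  using subst_const[of g 1] by (simp add: mpoly_const_def hom_one)

lemma subst_minus: "subst g (- f) = - subst g f"
  using subst_add[of g f "- f"] by (simp add: eq_neg_iff_add_eq_0 add.commute)

lemma subst_diff: "subst g (f - h) = subst g f - subst g h"
  using subst_add[of g f "- h"] by (simp add: subst_minus)

lemma subst_power: "subst g (f ^ j) = subst g f ^ j"
  by (induction j) (simp_all add: subst_mult)

lemma subst_prod: "subst g (prod f A) = (\<Prod>i\<in>A. subst g (f i))"
  by (induction A rule: infinite_finite_induct) (simp_all add: subst_mult)

end

interpretation mpoly: scalar_hom mpoly_const
  by standard (simp_all add: mpoly_const_def single_add mult_single)

lemma (in type_subring) poly_mem:
  assumes "h 0 = 0" "\<And>c. h c \<in> A" "w \<in> A"
  shows "poly (map_poly h p) w \<in> A"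
proof (induction p)
  case (pCons c p)
  then show ?case using assms by (auto simp: map_poly_pCons intro!: mems)
qed simp

lemma mpoly_subst_mem:
  assumes "\<And>v. g v \<in> carrier (mpoly_ring V)"
  shows "mpoly.subst g f \<in> carrier (mpoly_ring V)"
proof -
  interpret type_subring "carrier (mpoly_ring V)" by (rule mpoly_ring_subring)
  from mpoly_ring_UNIV[of f] show ?thesis
    by (induction f rule: mpoly_ring_induct) (auto simp: mpoly.subst_add mpoly.subst_mult assms intro: mems)
qed

lemma mpoly_subst_id:
  assumes "f \<in> carrier (mpoly_ring V)" "\<And>v. v \<in> V \<Longrightarrow> g v = mpoly_var v"
  shows "mpoly.subst g f = f"
  using assms by (induction f rule: mpoly_ring_induct) (simp_all add: mpoly.subst_add mpoly.subst_mult)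

text \<open>The subtraction of exponents is truncated; where \<open>v\<close> does not occur in
  \<open>\<mu>\<close>, the coefficient is 0, so truncation does no harm.\<close>

definition pderiv_monom :: "'v \<Rightarrow> ('v \<Rightarrow>\<^sub>0 nat) \<Rightarrow> 'k \<Rightarrow> ('v, 'k::comm_ring_1) mpoly" where
  "pderiv_monom v \<mu> c = Poly_Mapping.single (\<mu> - Poly_Mapping.single v 1) (of_nat (Poly_Mapping.lookup \<mu> v) * c)"

definition mpoly_pderiv :: "'v \<Rightarrow> ('v, 'k::comm_ring_1) mpoly \<Rightarrow> ('v, 'k) mpoly" where
  "mpoly_pderiv v f = (\<Sum>\<mu>\<in>Poly_Mapping.keys f. pderiv_monom v \<mu> (Poly_Mapping.lookup f \<mu>))"

lemma mpoly_pderiv_single: "mpoly_pderiv v (Poly_Mapping.single \<mu> c) = pderiv_monom v \<mu> c"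
  by (simp add: mpoly_pderiv_def pderiv_monom_def)

lemma mpoly_pderiv_add: "mpoly_pderiv v (f + g) = mpoly_pderiv v f + mpoly_pderiv v g"
  unfolding mpoly_pderiv_def
  by (rule setsum_keys_plus_distrib) (simp_all add: pderiv_monom_def single_add algebra_simps)

lemma mpoly_pderiv_sum: "mpoly_pderiv v (sum f A) = (\<Sum>i\<in>A. mpoly_pderiv v (f i))"
  by (induction A rule: infinite_finite_induct) (simp_all add: mpoly_pderiv_add, simp_all add: mpoly_pderiv_def)

lemma pderiv_monom_mult:
  "pderiv_monom v (\<mu> + \<nu>) (c * d) =
     pderiv_monom v \<mu> c * Poly_Mapping.single \<nu> d + Poly_Mapping.single \<mu> c * pderiv_monom v \<nu> d"
proof -
  have *: "\<kappa> - Poly_Mapping.single v 1 + \<kappa>' = \<kappa> + \<kappa>' - Poly_Mapping.single v 1"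
    if "Poly_Mapping.lookup \<kappa> v \<noteq> 0" for \<kappa> \<kappa>' :: "'a \<Rightarrow>\<^sub>0 nat"
    using that by (intro poly_mapping_eqI) (auto simp: lookup_add lookup_minus lookup_single when_def)
  have 1: "pderiv_monom v \<mu> c * Poly_Mapping.single \<nu> d =
      Poly_Mapping.single (\<mu> + \<nu> - Poly_Mapping.single v 1) (of_nat (Poly_Mapping.lookup \<mu> v) * (c * d))"
    by (cases "Poly_Mapping.lookup \<mu> v = 0")
      (simp_all add: pderiv_monom_def mult_single *[simplified] mult.assoc)
  have 2: "Poly_Mapping.single \<mu> c * pderiv_monom v \<nu> d =
      Poly_Mapping.single (\<mu> + \<nu> - Poly_Mapping.single v 1) (of_nat (Poly_Mapping.lookup \<nu> v) * (c * d))"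
    using *[of \<nu> \<mu>] by (cases "Poly_Mapping.lookup \<nu> v = 0")
      (simp_all add: pderiv_monom_def mult_single add.commute mult.left_commute)
  show ?thesis
    unfolding 1 2 by (simp add: pderiv_monom_def lookup_add algebra_simps flip: single_add)
qed

lemma mpoly_pderiv_mult:
  fixes f g :: "('v, 'k::comm_ring_1) mpoly"
  shows "mpoly_pderiv v (f * g) = mpoly_pderiv v f * g + f * mpoly_pderiv v g"
proof -
  let ?s = "\<lambda>f \<mu>. Poly_Mapping.single \<mu> (Poly_Mapping.lookup f \<mu>) :: ('v, 'k) mpoly"
  let ?d = "\<lambda>f \<mu>. pderiv_monom v \<mu> (Poly_Mapping.lookup f \<mu>) :: ('v, 'k) mpoly"
  have "mpoly_pderiv v (f * g) =
      mpoly_pderiv v ((\<Sum>\<mu>\<in>Poly_Mapping.keys f. ?s f \<mu>) * (\<Sum>\<nu>\<in>Poly_Mapping.keys g. ?s g \<nu>))"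
    by (simp flip: mpoly_eq_sum_single)
  also have "\<dots> = (\<Sum>\<mu>\<in>Poly_Mapping.keys f. ?d f \<mu>) * (\<Sum>\<nu>\<in>Poly_Mapping.keys g. ?s g \<nu>) +
      (\<Sum>\<mu>\<in>Poly_Mapping.keys f. ?s f \<mu>) * (\<Sum>\<nu>\<in>Poly_Mapping.keys g. ?d g \<nu>)"
    unfolding sum_product mpoly_pderiv_sum sum.distrib[symmetric]
    by (intro sum.cong refl) (simp add: mult_single mpoly_pderiv_single pderiv_monom_mult)
  also have "\<dots> = mpoly_pderiv v f * g + f * mpoly_pderiv v g"
    unfolding mpoly_pderiv_def by (simp flip: mpoly_eq_sum_single)
  finally show ?thesis .
qed

lemma is_derivation_mpoly_pderiv: "is_derivation (mpoly_pderiv v)"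
  by (simp add: is_derivation_def mpoly_pderiv_add mpoly_pderiv_mult)

lemma mpoly_pderiv_const [simp]: "mpoly_pderiv v (mpoly_const c) = 0"
  by (simp add: mpoly_const_def mpoly_pderiv_single pderiv_monom_def)

lemma mpoly_pderiv_var: "mpoly_pderiv v (mpoly_var w) = (if v = w then 1 else 0)"
  by (simp add: mpoly_var_def mpoly_pderiv_single pderiv_monom_def lookup_single when_def)

lemma mpoly_pderiv_other:
  assumes "f \<in> carrier (mpoly_ring V)" "v \<notin> V"
  shows "mpoly_pderiv v f = 0"
  using assms
  by (induction f rule: mpoly_ring_induct)
    (auto simp: mpoly_pderiv_add mpoly_pderiv_mult mpoly_pderiv_var)

text \<open>The Euler operator of \<open>v\<close> is diagonal in the monomial basis, with the
  exponents as eigenvalues.\<close>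

lemma mpoly_var_mult_pderiv:
  fixes f :: "('v, 'k::comm_ring_1) mpoly"
  shows "Poly_Mapping.lookup (mpoly_var v * mpoly_pderiv v f) \<mu> =
     of_nat (Poly_Mapping.lookup \<mu> v) * Poly_Mapping.lookup f \<mu>"
proof -
  have "mpoly_var v * pderiv_monom v \<nu> c = Poly_Mapping.single \<nu> (of_nat (Poly_Mapping.lookup \<nu> v) * c)"
    for \<nu> and c :: 'k
  proof (cases "Poly_Mapping.lookup \<nu> v = 0")
    case False
    then have "Poly_Mapping.single v 1 + (\<nu> - Poly_Mapping.single v 1) = \<nu>"
      by (intro poly_mapping_eqI) (auto simp: lookup_add lookup_minus lookup_single when_def)
    then show ?thesis by (simp add: mpoly_var_def pderiv_monom_def mult_single)
  qed (simp add: pderiv_monom_def)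
  then have "mpoly_var v * mpoly_pderiv v f = (\<Sum>\<nu>\<in>Poly_Mapping.keys f.
      Poly_Mapping.single \<nu> (of_nat (Poly_Mapping.lookup \<nu> v) * Poly_Mapping.lookup f \<nu>))"
    by (simp add: mpoly_pderiv_def sum_distrib_left)
  then show ?thesis
    by (auto simp: lookup_sum lookup_single when_def in_keys_iff)
qed

text \<open>In characteristic zero the eigenvalues \<open>w v\<close> fix the exponent of every
  variable in \<open>V\<close>, so \<open>f\<close> and \<open>g\<close> are multiples of one and
  the same monomial.\<close>

lemma proportional_if_euler_eigenvectors:
  fixes f g :: "('v, 'k::field_char_0) mpoly"
  assumes "f \<in> carrier (mpoly_ring V)" "g \<in> carrier (mpoly_ring V)" "g \<noteq> 0"
    and f: "\<And>v. v \<in> V \<Longrightarrow> mpoly_var v * mpoly_pderiv v f = of_nat (w v) * f"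
    and g: "\<And>v. v \<in> V \<Longrightarrow> mpoly_var v * mpoly_pderiv v g = of_nat (w v) * g"
  shows "\<exists>c. f = mpoly_const c * g"
proof -
  have scale: "Poly_Mapping.lookup (of_nat j * h) \<mu> = of_nat j * Poly_Mapping.lookup h \<mu>"
    for j \<mu> and h :: "('v, 'k) mpoly"
    by (induction j) (simp_all add: lookup_add algebra_simps)
  have w: "Poly_Mapping.lookup \<mu> v = w v"
    if "\<mu> \<in> Poly_Mapping.keys h" "v \<in> V" "\<And>v. v \<in> V \<Longrightarrow> mpoly_var v * mpoly_pderiv v h = of_nat (w v) * h"
    for \<mu> v and h :: "('v, 'k) mpoly"
  proof -
    have "of_nat (Poly_Mapping.lookup \<mu> v) * Poly_Mapping.lookup h \<mu> = Poly_Mapping.lookup (of_nat (w v) * h) \<mu>"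
      using that by (simp flip: mpoly_var_mult_pderiv)
    also have "\<dots> = of_nat (w v) * Poly_Mapping.lookup h \<mu>"
      by (rule scale)
    finally show ?thesis using that(1) by (simp add: in_keys_iff)
  qed
  from \<open>g \<noteq> 0\<close> obtain \<mu> where \<mu>: "\<mu> \<in> Poly_Mapping.keys g"
    by (metis ex_in_conv lookup_zero in_keys_iff poly_mapping_eqI)
  have unique: "\<nu> = \<mu>" if "\<nu> \<in> Poly_Mapping.keys f \<or> \<nu> \<in> Poly_Mapping.keys g" for \<nu>
  proof (rule poly_mapping_eqI)
    fix v
    have "Poly_Mapping.keys \<nu> \<subseteq> V" "Poly_Mapping.keys \<mu> \<subseteq> V"
      using that \<mu> assms(1,2) by (auto simp: mpoly_ring_def)
    then have "v \<notin> V \<Longrightarrow> Poly_Mapping.lookup \<nu> v = 0 \<and> Poly_Mapping.lookup \<mu> v = 0"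
      by (meson in_keys_iff subsetD)
    then show "Poly_Mapping.lookup \<nu> v = Poly_Mapping.lookup \<mu> v"
      using w[of \<nu> f v] w[of \<nu> g v] w[of \<mu> g v] f g that \<mu>
      by (cases "v \<in> V") auto
  qed
  let ?c = "Poly_Mapping.lookup f \<mu> / Poly_Mapping.lookup g \<mu>"
  have f_eq: "Poly_Mapping.lookup f \<nu> = ?c * Poly_Mapping.lookup g \<nu>" for \<nu>
  proof (cases "\<nu> = \<mu>")
    case True
    then show ?thesis using \<mu> by (simp add: in_keys_iff)
  next
    case False
    then have "Poly_Mapping.lookup f \<nu> = 0" "Poly_Mapping.lookup g \<nu> = 0"
      using unique[of \<nu>] by (meson in_keys_iff)+
    then show ?thesis by simp
  qed
  have scale_g: "Poly_Mapping.lookup (mpoly_const ?c * g) \<nu> = ?c * Poly_Mapping.lookup g \<nu>" for \<nu>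
    unfolding mpoly_const_def mult_map_scale_conv_mult[symmetric]
    by (simp add: Poly_Mapping.map.rep_eq when_def)
  have "f = mpoly_const ?c * g"
    by (rule poly_mapping_eqI) (unfold scale_g, rule f_eq)
  then show ?thesis ..
qed

section \<open>Extension of derivations to the field of fractions\<close>

definition fract_deriv :: "('a::idom \<Rightarrow> 'a) \<Rightarrow> 'a fract \<Rightarrow> 'a fract" where
  "fract_deriv d q = (case SOME (a, b). b \<noteq> 0 \<and> q = Fract a b of (a, b) \<Rightarrow> Fract (d a * b - a * d b) (b * b))"

text \<open>Independence of the chosen representative: differentiating
  \<open>a' * b = a * b'\<close> shows that the quotient rule gives equal fractions.\<close>

lemma fract_deriv_Fract:
  assumes d: "is_derivation d" and "b \<noteq> 0"
  shows "fract_deriv d (Fract a b) = Fract (d a * b - a * d b) (b * b)"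
proof -
  define P where "P = (\<lambda>(a', b'). b' \<noteq> 0 \<and> Fract a b = Fract a' b')"
  obtain a' b' where ab: "(SOME p. P p) = (a', b')" by fastforce
  have "P (a, b)" using assms by (simp add: P_def)
  then have "P (a', b')" unfolding ab[symmetric] by (rule someI)
  then have b': "b' \<noteq> 0" and eq: "a' * b = a * b'"
    using \<open>b \<noteq> 0\<close> by (auto simp: P_def eq_fract)
  have "d a' * b + a' * d b = d a * b' + a * d b'"
    using arg_cong[OF eq, of d] d by (simp add: derivation_mult)
  then have da': "d a' * b = d a * b' + a * d b' - a' * d b" by (simp add: eq_diff_eq)
  have "(d a' * b' - a' * d b') * (b * b) = (d a' * b) * (b * b') - (a' * b) * (d b' * b)"
    by (simp add: algebra_simps)
  also have "\<dots> = d a * b * (b' * b') + a * d b' * (b * b') - (a' * b) * (d b * b') - (a' * b) * (d b' * b)"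
    by (simp only: da') (simp add: algebra_simps)
  also have "\<dots> = (d a * b - a * d b) * (b' * b')"
    unfolding eq by (simp add: algebra_simps)
  finally have "(d a' * b' - a' * d b') * (b * b) = (d a * b - a * d b) * (b' * b')" .
  then show ?thesis
    using \<open>b \<noteq> 0\<close> b' ab unfolding fract_deriv_def P_def by (simp add: eq_fract)
qed

text \<open>The quotient rule freed of denominators; sums and products can then be differentiated
  after multiplication by a common denominator.\<close>

lemma fract_deriv_mult_denominator:
  assumes "is_derivation d" "b \<noteq> 0" "q * Fract b 1 = Fract a 1"
  shows "fract_deriv d q * Fract b 1 = Fract (d a) 1 - q * Fract (d b) 1"
proof -
  have "Fract b 1 \<noteq> 0" using assms(2) by (simp add: Zero_fract_def eq_fract)
  then have "q = Fract a 1 / Fract b 1" using assms(3) by (metis nonzero_eq_divide_eq)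
  also have "\<dots> = Fract a b" by simp
  finally have q: "q = Fract a b" .
  have "Fract (d a * b - a * d b) (b * b) * Fract b 1 = Fract (b * (d a * b - a * d b)) (b * (b * 1))"
    by (simp add: ac_simps)
  also have "\<dots> = Fract (d a * b - a * d b) b"
    unfolding mult_1_right by (rule mult_fract_cancel[OF assms(2)])
  also have "\<dots> = Fract (d a) 1 - Fract a b * Fract (d b) 1"
    using assms(2) by (simp add: algebra_simps)
  finally show ?thesis
    unfolding q fract_deriv_Fract[OF assms(1,2)] .
qed

lemma is_derivation_fract_deriv:
  assumes d: "is_derivation d"
  shows "is_derivation (fract_deriv d)"
  unfolding is_derivation_def
proof (intro conjI allI)
  fix p q :: "'a fract"
  define i where "i a = Fract a 1" for a :: 'a
  have i_add: "i (a + b) = i a + i b" and i_mult: "i (a * b) = i a * i b" for a b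
    by (simp_all add: i_def)
  have main: "fract_deriv d r * i b = i (d a) - r * i (d b)" if "r * i b = i a" "b \<noteq> 0" for r a b
    using fract_deriv_mult_denominator[OF d] that unfolding i_def by blast
  obtain a b where "p = Fract a b" and b: "b \<noteq> 0" by (cases p) auto
  then have p: "p * i b = i a" by (simp add: eq_fract i_def)
  obtain a' b' where "q = Fract a' b'" and b': "b' \<noteq> 0" by (cases q) auto
  then have q: "q * i b' = i a'" by (simp add: eq_fract i_def)
  have nz: "i (b * b') \<noteq> 0" using b b' by (simp add: Zero_fract_def eq_fract i_def)
  note dp = main[OF p b] and dq = main[OF q b']
  have "(p + q) * i (b * b') = (p * i b) * i b' + (q * i b') * i b"
    unfolding i_mult by (simp add: algebra_simps)
  then have "(p + q) * i (b * b') = i (a * b' + a' * b)"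
    unfolding p q i_mult i_add .
  from main[OF this] b b'
  have "fract_deriv d (p + q) * i (b * b') = i (d a) * i b' + (p * i b) * i (d b') +
      (i (d a') * i b + (q * i b') * i (d b)) - (p + q) * (i (d b) * i b' + i b * i (d b'))"
    by (simp only: derivation_add[OF d] derivation_mult[OF d] i_mult i_add p q) simp
  also have "\<dots> = (i (d a) - p * i (d b)) * i b' + (i (d a') - q * i (d b')) * i b"
    by (simp add: algebra_simps)
  also have "\<dots> = (fract_deriv d p + fract_deriv d q) * i (b * b')"
    unfolding dp[symmetric] dq[symmetric] i_mult by (simp add: algebra_simps)
  finally show "fract_deriv d (p + q) = fract_deriv d p + fract_deriv d q"
    using nz by simp
  have "(p * q) * i (b * b') = (p * i b) * (q * i b')"
    unfolding i_mult by (simp add: ac_simps)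
  then have "(p * q) * i (b * b') = i (a * a')"
    unfolding p q i_mult .
  from main[OF this] b b'
  have "fract_deriv d (p * q) * i (b * b') = i (d a) * (q * i b') + (p * i b) * i (d a')
      - p * q * (i (d b) * i b' + i b * i (d b'))"
    by (simp only: derivation_add[OF d] derivation_mult[OF d] i_mult i_add p q) simp
  also have "\<dots> = (i (d a) - p * i (d b)) * (q * i b') + (p * i b) * (i (d a') - q * i (d b'))"
    by (simp add: algebra_simps)
  also have "\<dots> = (fract_deriv d p * q + p * fract_deriv d q) * i (b * b')"
    unfolding dp[symmetric] dq[symmetric] i_mult by (simp add: algebra_simps)
  finally show "fract_deriv d (p * q) = fract_deriv d p * q + p * fract_deriv d q"
    using nz by simp
qed

lemma fract_deriv_embed: "is_derivation d \<Longrightarrow> fract_deriv d (Fract a 1) = Fract (d a) 1"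
  by (simp add: fract_deriv_Fract)

section \<open>Type classes versus rings with carrier\<close>

text \<open>Turns a ring type into a ring with carrier, so that maps from quotient rings and from
  \<open>UP R\<close> into a field type fit \<open>ring_hom\<close>.\<close>

definition type_ring :: "'a::comm_ring_1 ring" where
  "type_ring = \<lparr>carrier = UNIV, mult = (*), one = 1, zero = 0, add = (+)\<rparr>"

lemma type_ring_simps [simp]:
  "carrier type_ring = UNIV" "x \<otimes>\<^bsub>type_ring\<^esub> y = x * y" "\<one>\<^bsub>type_ring\<^esub> = 1"
  "\<zero>\<^bsub>type_ring\<^esub> = 0" "x \<oplus>\<^bsub>type_ring\<^esub> y = x + y"
  by (simp_all add: type_ring_def)

lemma cring_type_ring: "cring (type_ring :: 'a::comm_ring_1 ring)"
proof (rule cringI)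
  show "abelian_group (type_ring :: 'a ring)"
  proof (rule abelian_groupI)
    show "\<exists>y\<in>carrier type_ring. y \<oplus>\<^bsub>type_ring\<^esub> x = \<zero>\<^bsub>type_ring\<^esub>" for x :: 'a
      by (intro bexI[of _ "- x"]) simp_all
  qed (simp_all add: add.assoc add.commute)
  show "comm_monoid (type_ring :: 'a ring)"
    by (rule comm_monoidI) (simp_all add: mult.assoc mult.commute)
qed (simp add: distrib_right)

lemma type_ring_power [simp]: "x [^]\<^bsub>type_ring\<^esub> (j::nat) = x ^ j"
  by (induction j) (simp_all add: nat_pow_def mult.commute)

lemma type_ring_finsum: "finite A \<Longrightarrow> finsum type_ring f A = sum f A"
proof (induction rule: finite_induct)
  case (insert a A)
  interpret cring type_ring by (rule cring_type_ring)
  from insert show ?case by simp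
qed (simp add: finsum_def finprod_def)

lemma cring_mpoly_ring: "cring (mpoly_ring V :: ('v, 'k::comm_ring_1) mpoly ring)"
proof -
  interpret V: type_subring "carrier (mpoly_ring V :: ('v, 'k) mpoly ring)" by (rule mpoly_ring_subring)
  have ops: "x \<otimes>\<^bsub>mpoly_ring V\<^esub> y = x * y" "\<one>\<^bsub>mpoly_ring V\<^esub> = 1"
    "\<zero>\<^bsub>mpoly_ring V\<^esub> = 0" "x \<oplus>\<^bsub>mpoly_ring V\<^esub> y = x + y" for x y :: "('v, 'k) mpoly"
    by (simp_all add: mpoly_ring_def)
  show ?thesis
  proof (rule cringI)
    show "abelian_group (mpoly_ring V :: ('v, 'k) mpoly ring)"
    proof (rule abelian_groupI)
      show "\<exists>y\<in>carrier (mpoly_ring V). y \<oplus>\<^bsub>mpoly_ring V\<^esub> x = \<zero>\<^bsub>mpoly_ring V\<^esub>"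
        if "x \<in> carrier (mpoly_ring V)" for x :: "('v, 'k) mpoly"
        using that by (intro bexI[of _ "- x"]) (simp_all add: ops V.mems)
    qed (simp_all add: ops add.assoc add.commute V.mems)
    show "comm_monoid (mpoly_ring V :: ('v, 'k) mpoly ring)"
      by (rule comm_monoidI) (simp_all add: ops mult.assoc mult.commute V.mems)
  qed (simp add: ops distrib_right)
qed

text \<open>\<open>w\<close> is transcendental over the kernel of \<open>d\<close>: since
  \<open>d w = 1\<close>, applying \<open>d\<close> lowers the degree of a relation, and
  \<open>nat\<close> removes the factors \<open>Suc j\<close> that arise.\<close>

lemma sum_powers_eq_0:
  fixes w :: "'a::comm_ring_1"
  assumes d: "is_derivation d" "d w = 1"
    and nat: "\<And>j x. of_nat (Suc j) * x = (0::'a) \<Longrightarrow> x = 0"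
    and "\<And>j. j \<le> N \<Longrightarrow> d (c j) = 0" "(\<Sum>j\<le>N. c j * w ^ j) = 0" "i \<le> N"
  shows "c i = 0"
  using assms(4-)
proof (induction N arbitrary: c i)
  case 0
  then show ?case by simp
next
  case (Suc N)
  have "(\<Sum>j\<le>Suc N. c j * w ^ j) = c 0 + (\<Sum>j\<le>N. c (Suc j) * w ^ Suc j)"
    by (simp add: sum.atMost_Suc_shift del: sum.atMost_Suc)
  with Suc.prems have eq: "c 0 + (\<Sum>j\<le>N. c (Suc j) * w ^ Suc j) = 0" by simp
  have "(\<Sum>j\<le>N. of_nat (Suc j) * c (Suc j) * w ^ j) = d (c 0 + (\<Sum>j\<le>N. c (Suc j) * w ^ Suc j))"
  proof -
    have "d (c (Suc j) * w ^ Suc j) = of_nat (Suc j) * c (Suc j) * w ^ j" if "j \<le> N" for j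
      using Suc.prems(1)[of "Suc j"] that
      by (simp add: derivation_mult[OF d(1)] derivation_power[OF d(1)] d(2) ac_simps del: power_Suc of_nat_Suc)
    then show ?thesis
      using Suc.prems(1)[of 0] by (simp add: derivation_add[OF d(1)] derivation_sum[OF d(1)] del: power_Suc of_nat_Suc)
  qed
  then have "(\<Sum>j\<le>N. of_nat (Suc j) * c (Suc j) * w ^ j) = 0"
    unfolding eq using d by simp
  moreover have "d (of_nat (Suc j) * c (Suc j)) = 0" if "j \<le> N" for j
  proof -
    have "d (of_nat k) = 0" for k by (induction k) (use d in \<open>simp_all add: derivation_add\<close>)
    then show ?thesis using that Suc.prems(1)[of "Suc j"] by (simp add: derivation_mult[OF d(1)] del: of_nat_Suc)
  qed
  ultimately have "of_nat (Suc j) * c (Suc j) = 0" if "j \<le> N" for j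
    using Suc.IH[of "\<lambda>j. of_nat (Suc j) * c (Suc j)"] that by blast
  then have c: "c (Suc j) = 0" if "j \<le> N" for j using that nat by blast
  then show ?case using eq Suc.prems(3) by (cases i) simp_all
qed

text \<open>Evaluation at \<open>w\<close> is injective because the image of \<open>R\<close> lies
  in the kernel of \<open>d\<close>, over which \<open>w\<close> is transcendental.\<close>

lemma UP_eval_into_type:
  fixes h :: "'b \<Rightarrow> 'a::comm_ring_1"
  assumes R: "cring R" and h: "h \<in> ring_hom R type_ring" "inj_on h (carrier R)"
    and d: "is_derivation d" "d w = 1" "\<And>a. a \<in> carrier R \<Longrightarrow> d (h a) = 0"
    and nat: "\<And>j x. of_nat (Suc j) * x = (0::'a) \<Longrightarrow> x = 0"
  obtains \<Phi> where "\<Phi> \<in> ring_hom (UP R) type_ring" "inj_on \<Phi> (carrier (UP R))"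
    "\<And>a. a \<in> carrier R \<Longrightarrow> \<Phi> (up_ring.monom (UP R) a 0) = h a"
    "\<Phi> (up_ring.monom (UP R) \<one>\<^bsub>R\<^esub> 1) = w"
    "\<And>f. f \<in> carrier (UP R) \<Longrightarrow> \<exists>N c. (\<forall>j. c j \<in> carrier R) \<and> \<Phi> f = (\<Sum>j\<le>N. h (c j) * w ^ j)"
proof -
  interpret R: cring R by (fact R)
  interpret S: cring "type_ring :: 'a ring" by (rule cring_type_ring)
  interpret ring_hom_cring R type_ring h
    using h by (intro ring_hom_cringI) (auto simp: R S.is_cring)
  interpret U: UP_pre_univ_prop R type_ring h "UP R"
    by (intro UP_pre_univ_prop.intro UP_cring.intro ring_hom_cring_axioms R) simp
  define \<Phi> where "\<Phi> = eval R type_ring h w"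
  have val: "\<Phi> f = (\<Sum>j\<le>deg R f. h (up_ring.coeff (UP R) f j) * w ^ j)" if "f \<in> carrier (UP R)" for f
    using that unfolding \<Phi>_def by (simp add: U.eval_on_carrier type_ring_finsum)
  have hom: "\<Phi> \<in> ring_hom (UP R) type_ring"
    unfolding \<Phi>_def by (rule U.eval_ring_hom) simp
  interpret \<Phi>: ring_hom_cring "UP R" type_ring \<Phi>
    using hom by (intro ring_hom_cringI) (auto simp: U.UP_cring S.is_cring)
  have ker: "f = \<zero>\<^bsub>UP R\<^esub>" if f: "f \<in> carrier (UP R)" "\<Phi> f = 0" for f
  proof (rule U.up_eqI)
    fix j
    have "up_ring.coeff (UP R) f j = \<zero>\<^bsub>R\<^esub>"
    proof (cases "j \<le> deg R f")
      case True
      have "h (up_ring.coeff (UP R) f j) = 0"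
        by (rule sum_powers_eq_0[of d w "deg R f" "\<lambda>j. h (up_ring.coeff (UP R) f j)"])
          (use d nat f val True in auto)
      then show ?thesis
        using inj_onD[OF h(2), of "up_ring.coeff (UP R) f j" "\<zero>\<^bsub>R\<^esub>"] f by simp
    qed (use f U.deg_aboveD in simp)
    then show "up_ring.coeff (UP R) f j = up_ring.coeff (UP R) \<zero>\<^bsub>UP R\<^esub> j" by simp
  qed (use f in simp_all)
  have inj: "inj_on \<Phi> (carrier (UP R))"
  proof (rule inj_onI)
    fix f g assume fg: "f \<in> carrier (UP R)" "g \<in> carrier (UP R)" "\<Phi> f = \<Phi> g"
    have "f \<ominus>\<^bsub>UP R\<^esub> g \<oplus>\<^bsub>UP R\<^esub> g = f"
      using fg(1,2) by (simp add: U.P.minus_eq U.P.a_assoc U.P.l_neg)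
    then have "\<Phi> (f \<ominus>\<^bsub>UP R\<^esub> g) + \<Phi> g = \<Phi> f"
      using fg(1,2) \<Phi>.hom_add[of "f \<ominus>\<^bsub>UP R\<^esub> g" g] by simp
    then have "f \<ominus>\<^bsub>UP R\<^esub> g = \<zero>\<^bsub>UP R\<^esub>" using fg by (intro ker) simp_all
    then show "f = g" using fg(1,2) by simp
  qed
  show thesis
  proof (rule that[OF hom inj])
    show "\<Phi> (up_ring.monom (UP R) a 0) = h a" if "a \<in> carrier R" for a
      unfolding \<Phi>_def using that by (intro U.eval_const) simp_all
    show "\<Phi> (up_ring.monom (UP R) \<one>\<^bsub>R\<^esub> 1) = w"
      unfolding \<Phi>_def by (intro U.eval_monom1) simp
    show "\<exists>N c. (\<forall>j. c j \<in> carrier R) \<and> \<Phi> f = (\<Sum>j\<le>N. h (c j) * w ^ j)" if "f \<in> carrier (UP R)" for f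
      using val[OF that] U.coeff_closed[OF that] by blast
  qed
qed

lemma hom_type_ring_zero:
  assumes "cring A" "\<Phi> \<in> ring_hom A type_ring"
  shows "\<Phi> \<zero>\<^bsub>A\<^esub> = 0"
proof -
  interpret A: cring A by fact
  have "\<Phi> (\<zero>\<^bsub>A\<^esub> \<oplus>\<^bsub>A\<^esub> \<zero>\<^bsub>A\<^esub>) = \<Phi> \<zero>\<^bsub>A\<^esub> + \<Phi> \<zero>\<^bsub>A\<^esub>"
    using ring_hom_add[OF assms(2) A.zero_closed A.zero_closed] by simp
  then show ?thesis by simp
qed

lemma type_subring_hom_image:
  fixes \<Phi> :: "'b \<Rightarrow> 'a::comm_ring_1"
  assumes A: "cring A" and \<Phi>: "\<Phi> \<in> ring_hom A type_ring" and H: "subring H A"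
  shows "type_subring (\<Phi> ` H)"
proof -
  interpret A: cring A by (fact A)
  note H = subringE[OF H]
  note hom = ring_hom_add[OF \<Phi>, simplified] ring_hom_mult[OF \<Phi>, simplified]
    ring_hom_one[OF \<Phi>, simplified]
  show ?thesis
  proof
    show "1 \<in> \<Phi> ` H" using H(3) hom(3) by (metis imageI)
    fix a assume "a \<in> \<Phi> ` H"
    then obtain f where f: "f \<in> H" "f \<in> carrier A" "a = \<Phi> f" using H(1) by blast
    have "\<Phi> (f \<oplus>\<^bsub>A\<^esub> \<ominus>\<^bsub>A\<^esub> f) = 0"
      using hom_type_ring_zero[OF A \<Phi>] A.r_neg[OF f(2)] by simp
    then have "\<Phi> f + \<Phi> (\<ominus>\<^bsub>A\<^esub> f) = 0"
      using f(2) by (simp only: hom A.a_inv_closed)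
    then have "- a = \<Phi> (\<ominus>\<^bsub>A\<^esub> f)" unfolding f(3) by (rule minus_unique)
    then show "- a \<in> \<Phi> ` H" using H(5)[OF f(1)] by simp
    fix b assume "b \<in> \<Phi> ` H"
    then obtain g where g: "g \<in> H" "g \<in> carrier A" "b = \<Phi> g" using H(1) by blast
    show "a + b \<in> \<Phi> ` H"
      using imageI[OF H(7)[OF f(1) g(1)], of \<Phi>] unfolding hom(1)[OF f(2) g(2)] f(3) g(3) .
    show "a * b \<in> \<Phi> ` H"
      using imageI[OF H(6)[OF f(1) g(1)], of \<Phi>] unfolding hom(2)[OF f(2) g(2)] f(3) g(3) .
  qed
qed

section \<open>Derivations transported along an embedding\<close>

lemma derivation_over_scalar:
  assumes "cring A" "derivation_over \<phi> A D" "\<phi> c \<in> carrier A"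
  shows "D (\<phi> c) = \<zero>\<^bsub>A\<^esub>"
proof -
  interpret A: cring A by fact
  have D: "D \<in> carrier A \<rightarrow> carrier A"
    "\<And>b. b \<in> carrier A \<Longrightarrow> D (\<phi> c \<otimes>\<^bsub>A\<^esub> b) = \<phi> c \<otimes>\<^bsub>A\<^esub> D b"
    "\<And>a b. a \<in> carrier A \<Longrightarrow> b \<in> carrier A \<Longrightarrow>
      D (a \<otimes>\<^bsub>A\<^esub> b) = (D a \<otimes>\<^bsub>A\<^esub> b) \<oplus>\<^bsub>A\<^esub> (a \<otimes>\<^bsub>A\<^esub> D b)"
    using assms(2) unfolding derivation_over_def by blast+
  have D1: "D \<one>\<^bsub>A\<^esub> \<in> carrier A" using D(1) by auto
  have "D \<one>\<^bsub>A\<^esub> = D \<one>\<^bsub>A\<^esub> \<oplus>\<^bsub>A\<^esub> D \<one>\<^bsub>A\<^esub>"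
    using D(3)[of "\<one>\<^bsub>A\<^esub>" "\<one>\<^bsub>A\<^esub>"] D1 by simp
  then have "D \<one>\<^bsub>A\<^esub> = \<zero>\<^bsub>A\<^esub>" using D1 by (metis A.add.r_cancel_one')
  then show ?thesis using D(2)[of "\<one>\<^bsub>A\<^esub>"] assms(3) by simp
qed

text \<open>The image of \<open>A\<close> is stable under \<open>D\<close>, so \<open>D\<close> can
  be conjugated by \<open>\<Phi>\<close>; injectivity of \<open>\<Phi>\<close> reduces the required
  identities to those of \<open>D\<close>.\<close>

lemma locally_nilpotent_derivation_pullback:
  fixes \<Phi> :: "'b \<Rightarrow> 'a::comm_ring_1"
  assumes A: "cring A" and \<Phi>: "\<Phi> \<in> ring_hom A type_ring" "inj_on \<Phi> (carrier A)"
    and \<phi>: "\<And>c. \<phi> c \<in> carrier A" "\<And>c. D (\<Phi> (\<phi> c)) = 0"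
    and D: "is_derivation D" "\<And>b. b \<in> carrier A \<Longrightarrow> D (\<Phi> b) \<in> \<Phi> ` carrier A"
      "\<And>b. b \<in> carrier A \<Longrightarrow> nilpotent_at D (\<Phi> b)"
  obtains D' where "locally_nilpotent_derivation \<phi> A D'" "\<And>b. b \<in> carrier A \<Longrightarrow> \<Phi> (D' b) = D (\<Phi> b)"
proof -
  interpret A: cring A by (fact A)
  define D' where "D' b = inv_into (carrier A) \<Phi> (D (\<Phi> b))" for b
  have closed: "D' b \<in> carrier A" and val: "\<Phi> (D' b) = D (\<Phi> b)" if "b \<in> carrier A" for b
    using D(2)[OF that] unfolding D'_def by (auto intro: inv_into_into f_inv_into_f)
  note hom = ring_hom_add[OF \<Phi>(1), simplified] ring_hom_mult[OF \<Phi>(1), simplified]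
  note inj = inj_onD[OF \<Phi>(2)]
  have iterate: "(D' ^^ N) b \<in> carrier A \<and> \<Phi> ((D' ^^ N) b) = (D ^^ N) (\<Phi> b)" if "b \<in> carrier A" for b N
    by (induction N) (use that closed val in auto)
  note zero = hom_type_ring_zero[OF A \<Phi>(1)]
  have "derivation_over \<phi> A D'"
    unfolding derivation_over_def
    by (intro conjI ballI allI funcsetI inj)
      (simp_all add: closed val hom \<phi> derivation_add[OF D(1)] derivation_mult[OF D(1)])
  moreover have "\<exists>N\<ge>1. (D' ^^ N) b = \<zero>\<^bsub>A\<^esub>" if b: "b \<in> carrier A" for b
  proof -
    obtain N where "(D ^^ N) (\<Phi> b) = 0" using D(3)[OF b] by (auto simp: nilpotent_at_def)
    \<comment> \<open>\<open>nilpotent_at\<close> allows the exponent 0, while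
      \<open>locally_nilpotent_derivation\<close> asks for at least 1.\<close>
    then have "(D ^^ Suc N) (\<Phi> b) = 0" using D(1) by simp
    then have "(D' ^^ Suc N) b = \<zero>\<^bsub>A\<^esub>"
      using iterate[OF b, of "Suc N"] zero by (intro inj) auto
    then show ?thesis by (intro exI[of _ "Suc N"]) simp
  qed
  ultimately show thesis
    using that[of D'] val unfolding locally_nilpotent_derivation_def by blast
qed

section \<open>The cylinder inside a field of rational functions\<close>

type_synonym 'k ratfun = "(var, 'k) mpoly fract"

definition emb :: "(var, 'k::field) mpoly \<Rightarrow> 'k ratfun" where "emb f = Fract f 1"

lemma emb_add: "emb (f + g) = emb f + emb g"
  and emb_mult: "emb (f * g) = emb f * emb g"
  and emb_minus: "emb (- f) = - emb f"
  and emb_0 [simp]: "emb 0 = 0"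
  and emb_1 [simp]: "emb 1 = 1"
  by (simp_all add: emb_def Zero_fract_def One_fract_def)

lemma emb_eq_iff [simp]: "emb f = emb g \<longleftrightarrow> f = g"
  by (simp add: emb_def eq_fract)

lemma emb_eq_0_iff [simp]: "emb f = 0 \<longleftrightarrow> f = 0"
  using emb_eq_iff[of f 0] by simp

lemma emb_power: "emb (f ^ j) = emb f ^ j"
  by (induction j) (simp_all add: emb_mult)

lemma emb_prod: "emb (prod f A) = (\<Prod>i\<in>A. emb (f i))"
  by (induction A rule: infinite_finite_induct) (simp_all add: emb_mult)

lemma mpoly_var_nonzero [simp]: "mpoly_var v \<noteq> (0 :: ('v, 'k::zero_neq_one) mpoly)"
proof
  assume "mpoly_var v = (0 :: ('v, 'k) mpoly)"
  then have "Poly_Mapping.keys (mpoly_var v :: ('v, 'k) mpoly) = {}" by simp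
  then show False by (simp add: mpoly_var_def)
qed

definition scal :: "'k::field \<Rightarrow> 'k ratfun" where "scal c = emb (mpoly_const c)"

interpretation scal: scalar_hom scal
  by standard (simp_all add: scal_def mpoly.hom_one mpoly.hom_add mpoly.hom_mult emb_add emb_mult)

lemma scal_of_nat: "scal (of_nat j) = of_nat j"
  by (induction j) (simp_all add: scal.hom_zero scal.hom_add scal.hom_one)

lemma scal_inverse: "scal (inverse c) = inverse (scal c)"
proof (cases "c = 0")
  case False
  then have "scal (inverse c) * scal c = 1"
    by (simp add: scal.hom_one flip: scal.hom_mult)
  then show ?thesis by (metis inverse_unique mult.commute)
qed (simp add: scal.hom_zero)

lemma ratfun_of_nat_mult_eq_0:
  fixes x :: "'k::field_char_0 ratfun"
  assumes "of_nat (Suc j) * x = 0"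
  shows "x = 0"
proof -
  have "(of_nat (Suc j) :: 'k ratfun) = emb (of_nat (Suc j))"
    by (simp only: emb_def of_nat_fract)
  then have "(of_nat (Suc j) :: 'k ratfun) \<noteq> 0" by (simp del: of_nat_Suc)
  with assms show ?thesis by simp
qed

definition part :: "var \<Rightarrow> 'k::field ratfun \<Rightarrow> 'k ratfun" where
  "part v = fract_deriv (mpoly_pderiv v)"

lemma is_derivation_part [simp]: "is_derivation (part v)"
  unfolding part_def by (intro is_derivation_fract_deriv is_derivation_mpoly_pderiv)

lemma part_emb: "part v (emb f) = emb (mpoly_pderiv v f)"
  unfolding part_def emb_def by (intro fract_deriv_embed is_derivation_mpoly_pderiv)

lemma part_scal [simp]: "part v (scal c) = 0"
  by (simp add: scal_def part_emb)

lemma part_var: "part v (emb (mpoly_var w)) = (if v = w then 1 else 0)"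
  by (simp add: part_emb mpoly_pderiv_var)

lemma part_other: "f \<in> carrier (mpoly_ring V) \<Longrightarrow> v \<notin> V \<Longrightarrow> part v (emb f) = 0"
  by (simp add: part_emb mpoly_pderiv_other)

text \<open>In the field of rational functions \<open>y\<close> is determined by the other variables, so the
  variable \<open>Y\<close> is free to serve as the coordinate of the cylinder.\<close>

locale cylinder_ring =
  fixes q r m :: nat and n :: "nat \<Rightarrow> nat" and p :: "'k::field_char_0 poly"
  assumes qr: "q \<ge> 1" "r \<ge> 1" and n: "\<And>i. i \<le> m \<Longrightarrow> n i \<ge> 1"
begin

definition "V = X ` {..m} \<union> {Y, Z, T}"
definition M :: "(var, 'k) mpoly" where "M = (\<Prod>i\<le>m. mpoly_var (X i) ^ n i)"
definition G0 :: "(var, 'k) mpoly" where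
  "G0 = mpoly_var Z ^ q + mpoly_var T ^ r
     + mpoly_var (X 0) * poly (map_poly mpoly_const p) (\<Prod>i\<le>m. mpoly_var (X i))"
definition F :: "(var, 'k) mpoly" where "F = M * mpoly_var Y + G0"
definition yv :: "'k ratfun" where "yv = - emb G0 / emb M"
definition ev :: "(var, 'k) mpoly \<Rightarrow> 'k ratfun" where
  "ev = scal.subst (\<lambda>v. if v = Y then yv else emb (mpoly_var v))"

abbreviation "RR \<equiv> R_ring q r m n p"
abbreviation "PP \<equiv> carrier (mpoly_ring V) :: (var, 'k) mpoly set"
abbreviation "PP' \<equiv> carrier (mpoly_ring (V - {Y})) :: (var, 'k) mpoly set"

lemma R_relation_eq: "R_relation q r m n p = F"
  by (simp add: R_relation_def F_def M_def G0_def add.assoc)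

lemma R_poly_ring_eq: "R_poly_ring m = mpoly_ring V"
  by (simp add: R_poly_ring_def V_def)

lemma M_nonzero: "M \<noteq> 0"
  by (simp add: M_def)

sublocale P: type_subring PP by (rule mpoly_ring_subring)
sublocale P': type_subring PP' by (rule mpoly_ring_subring)

lemma M_mem: "M \<in> PP'"
  unfolding M_def by (intro P'.prod_mem P'.power_mem var_mem_mpoly_ring) (auto simp: V_def)

lemma G0_mem: "G0 \<in> PP'"
  unfolding G0_def
  by (intro P'.mems P'.poly_mem P'.prod_mem var_mem_mpoly_ring) (auto simp: V_def mpoly_const_def[of 0])

lemma PP'_subset: "PP' \<subseteq> PP"
  by (auto simp: mpoly_ring_def)

lemma F_mem: "F \<in> PP"
  unfolding F_def using M_mem G0_mem PP'_subset
  by (intro P.mems var_mem_mpoly_ring) (auto simp: V_def)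

lemma ev_PP': "f \<in> PP' \<Longrightarrow> ev f = emb f"
  by (induction f rule: mpoly_ring_induct)
    (auto simp: ev_def scal.subst_add scal.subst_mult scal_def emb_add emb_mult)

lemma ev_hom: "ev (f + g) = ev f + ev g" "ev (f * g) = ev f * ev g" "ev (f - g) = ev f - ev g" "ev 1 = 1"
  by (simp_all add: ev_def scal.subst_add scal.subst_mult scal.subst_diff)

lemma ev_F: "ev F = 0"
proof -
  have "ev F = emb M * yv + emb G0"
    unfolding F_def using M_mem G0_mem by (simp add: ev_hom ev_PP') (simp add: ev_def)
  then show ?thesis using M_nonzero by (simp add: yv_def)
qed

text \<open>Modulo \<open>F\<close>, the product of \<open>M\<close> and \<open>Y\<close> is
  \<open>- G0\<close>, which is free of \<open>Y\<close>; enough factors \<open>M\<close> therefore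
  remove \<open>Y\<close>.\<close>

lemma eliminate_Y:
  assumes "f \<in> PP"
  shows "\<exists>N. \<exists>g\<in>PP'. F dvd M ^ N * f - g"
  using assms
proof (induction f rule: mpoly_ring_induct)
  case (const c)
  show ?case by (intro exI[of _ 0] bexI[of _ "mpoly_const c"]) simp_all
next
  case (var v)
  show ?case
  proof (cases "v = Y")
    case True
    have "M ^ 1 * mpoly_var v - (- G0) = F" by (simp add: F_def True)
    then have "F dvd M ^ 1 * mpoly_var v - (- G0)" by simp
    then show ?thesis using P'.uminus_mem[OF G0_mem] by blast
  next
    case False
    then show ?thesis using var
      by (intro exI[of _ 0] bexI[of _ "mpoly_var v"]) (simp_all add: var_mem_mpoly_ring)
  qed
next
  case (add f f')
  then obtain N N' g g' where g: "g \<in> PP'" "g' \<in> PP'" "F dvd M ^ N * f - g" "F dvd M ^ N' * f' - g'"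
    by blast
  have "M ^ (N + N') * (f + f') - (M ^ N' * g + M ^ N * g') =
      M ^ N' * (M ^ N * f - g) + M ^ N * (M ^ N' * f' - g')"
    by (simp add: power_add algebra_simps)
  also have "F dvd \<dots>" using g by (intro dvd_add dvd_mult)
  finally show ?case using g
    by (intro exI[of _ "N + N'"] bexI[of _ "M ^ N' * g + M ^ N * g'"]) (auto intro!: P'.mems M_mem)
next
  case (mult f f')
  then obtain N N' g g' where g: "g \<in> PP'" "g' \<in> PP'" "F dvd M ^ N * f - g" "F dvd M ^ N' * f' - g'"
    by blast
  have "M ^ (N + N') * (f * f') - g * g' = (M ^ N' * f') * (M ^ N * f - g) + g * (M ^ N' * f' - g')"
    by (simp add: power_add algebra_simps)
  also have "F dvd \<dots>" using g by (intro dvd_add dvd_mult)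
  finally show ?case using g
    by (intro exI[of _ "N + N'"] bexI[of _ "g * g'"]) (auto intro!: P'.mems)
qed

lemma dvd_minus_subst_zero:
  "mpoly_var w dvd f - mpoly.subst (\<lambda>v. if v = w then 0 else mpoly_var v) f"
  using mpoly_ring_UNIV[of f]
proof (induction f rule: mpoly_ring_induct)
  case (mult f g)
  let ?s = "mpoly.subst (\<lambda>v. if v = w then 0 else mpoly_var v)"
  have "f * g - ?s (f * g) = g * (f - ?s f) + ?s f * (g - ?s g)"
    by (simp add: mpoly.subst_mult algebra_simps)
  also have "mpoly_var w dvd \<dots>" using mult by (intro dvd_add dvd_mult)
  finally show ?case .
next
  case (add f g)
  let ?s = "mpoly.subst (\<lambda>v. if v = w then 0 else mpoly_var v)"
  have "f + g - ?s (f + g) = (f - ?s f) + (g - ?s g)"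
    by (simp add: mpoly.subst_add algebra_simps)
  also have "mpoly_var w dvd \<dots>" using add by (intro dvd_add)
  finally show ?case .
qed simp_all

text \<open>Modulo \<open>X i\<close>, the polynomial \<open>F\<close> does not vanish because it still involves \<open>Z ^ q\<close>.\<close>

lemma cancel_var:
  assumes i: "i \<le> m" and dvd: "F dvd mpoly_var (X i) * f"
  shows "F dvd f"
proof -
  obtain g where g: "mpoly_var (X i) * f = F * g" using dvd by (auto elim: dvdE)
  let ?s = "mpoly.subst (\<lambda>v. if v = X i then 0 else mpoly_var v)"
  \<comment> \<open>\<open>?s\<close> reduces modulo \<open>X i\<close>; \<open>?t\<close> then
    discards all variables but \<open>Z\<close>, leaving \<open>Z ^ q\<close> of
    \<open>F\<close>.\<close>
  let ?t = "mpoly.subst (\<lambda>v. if v = Z then mpoly_var Z else 0)"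
  have M0: "?s M = 0"
    unfolding M_def mpoly.subst_prod mpoly.subst_power using i n[OF i]
    by (intro prod_zero bexI[of _ i]) simp_all
  have "?t (?s F) = mpoly_var Z ^ q"
    unfolding F_def G0_def using M0 qr
    by (simp add: mpoly.subst_add mpoly.subst_mult mpoly.subst_power)
  then have "?s F \<noteq> 0" by auto
  moreover have "?s F * ?s g = 0"
    using arg_cong[OF g, of ?s] by (simp add: mpoly.subst_mult)
  ultimately have "mpoly_var (X i) dvd g"
    using dvd_minus_subst_zero[of "X i" g] by simp
  then obtain h where "g = mpoly_var (X i) * h" by (auto elim: dvdE)
  with g have "mpoly_var (X i) * f = mpoly_var (X i) * (F * h)" by (simp add: ac_simps)
  then have "f = F * h" by simp
  then show ?thesis by simp
qed

text \<open>The elements that can be cancelled modulo \<open>F\<close> are closed under products,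
  and \<open>M\<close> is a product of powers of the variables \<open>X i\<close>.\<close>

lemma cancel_M:
  assumes "F dvd M ^ N * f"
  shows "F dvd f"
proof -
  define can where "can = {c. \<forall>f. F dvd c * f \<longrightarrow> F dvd f}"
  have can_mult: "a * b \<in> can" if "a \<in> can" "b \<in> can" for a b
    using that unfolding can_def mem_Collect_eq mult.assoc by blast
  have can_1: "1 \<in> can" by (simp add: can_def)
  have can_power: "a ^ j \<in> can" if "a \<in> can" for a j
    by (induction j) (use that in \<open>auto intro: can_1 can_mult\<close>)
  have "mpoly_var (X i) \<in> can" if "i \<le> m" for i
    using cancel_var[OF that] unfolding can_def by blast
  then have "(\<Prod>i\<in>A. mpoly_var (X i) ^ n i) \<in> can" if "A \<subseteq> {..m}" for A
    using that by (induction A rule: infinite_finite_induct) (auto intro: can_1 can_mult can_power)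
  then have "M ^ N \<in> can" unfolding M_def by (intro can_power) simp
  with assms show ?thesis unfolding can_def by blast
qed

text \<open>After elimination of \<open>Y\<close>, the remainder \<open>g\<close> is embedded
  faithfully, so it vanishes together with \<open>ev f\<close>; then \<open>F\<close> divides
  \<open>M ^ N * f\<close>, and \<open>M ^ N\<close> can be cancelled.\<close>

lemma ev_eq_0_iff:
  assumes "f \<in> PP"
  shows "ev f = 0 \<longleftrightarrow> f \<in> R_ideal q r m n p"
proof
  assume "f \<in> R_ideal q r m n p"
  then obtain g where "f = g * F"
    by (auto simp: R_ideal_def cgenideal_def R_relation_eq R_poly_ring_eq mpoly_ring_def)
  then show "ev f = 0" by (simp add: ev_hom ev_F)
next
  assume f: "ev f = 0"
  obtain N g where g: "g \<in> PP'" "F dvd M ^ N * f - g" using eliminate_Y[OF assms] by blast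
  then obtain h where h: "M ^ N * f - g = F * h" by (auto elim: dvdE)
  have "emb g = ev (M ^ N * f) - ev (F * h)"
    unfolding h[symmetric] by (simp add: ev_hom ev_PP' g)
  then have "g = 0" by (simp add: ev_hom ev_F f)
  with g(2) have "F dvd M ^ N * f" by simp
  then have "F dvd f" by (rule cancel_M)
  then obtain h where h: "f = F * h" by (auto elim: dvdE)
  \<comment> \<open>The cofactor \<open>h\<close> may involve any variables; setting those outside
    \<open>V\<close> to 0 moves it into the ring without changing \<open>f\<close> or
    \<open>F\<close>.\<close>
  let ?s = "mpoly.subst (\<lambda>v. if v \<in> V then mpoly_var v else 0)"
  have "f = ?s h * F"
    using arg_cong[OF h, of ?s] assms F_mem by (simp add: mpoly.subst_mult mpoly_subst_id mult.commute)
  moreover have "?s h \<in> PP"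
    by (intro mpoly_subst_mem) (simp add: var_mem_mpoly_ring)
  ultimately show "f \<in> R_ideal q r m n p"
    by (auto simp: R_ideal_def cgenideal_def R_relation_eq R_poly_ring_eq) (auto simp: mpoly_ring_def)
qed

section \<open>Generators of the cylinder inside the field\<close>

definition gens :: "'k ratfun set" where
  "gens = range scal \<union> (\<lambda>i. emb (mpoly_var (X i))) ` {..m}
     \<union> {yv, emb (mpoly_var Z), emb (mpoly_var T), emb (mpoly_var Y)}"

lemma ev_var_mem: "v \<in> V \<Longrightarrow> ev (mpoly_var v) \<in> adjoin gens"
  by (auto simp: V_def gens_def ev_def intro: adjoin.gen)

lemma ev_mem: "f \<in> PP \<Longrightarrow> ev f \<in> adjoin gens"
proof (induction f rule: mpoly_ring_induct)
  case (const c)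
  show ?case by (auto simp: gens_def ev_def intro: adjoin.gen)
qed (simp_all add: ev_var_mem ev_hom adjoin.mems)

lemma part_Y_yv: "part Y yv = 0"
  unfolding yv_def divide_inverse
  by (simp add: derivation_mult[OF is_derivation_part] derivation_minus[OF is_derivation_part]
    derivation_inverse[OF is_derivation_part] part_other[OF G0_mem] part_other[OF M_mem])

lemma part_Y_ev: "f \<in> PP \<Longrightarrow> part Y (ev f) = 0"
proof (induction f rule: mpoly_ring_induct)
  case (var v)
  then show ?case by (auto simp: ev_def part_Y_yv part_var)
qed (simp_all add: ev_hom derivation_add[OF is_derivation_part] derivation_mult[OF is_derivation_part],
  simp add: ev_def)

text \<open>First isomorphism theorem: the kernel of \<open>ev\<close> is the defining ideal, so
  \<open>ev\<close> descends to an embedding of the quotient.\<close>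

lemma cring_RR: "cring RR"
  and RR_embedding: "\<exists>h. h \<in> ring_hom RR type_ring \<and> inj_on h (carrier RR) \<and>
    (\<forall>f\<in>PP. R_ideal q r m n p +>\<^bsub>R_poly_ring m\<^esub> f \<in> carrier RR \<and> h (R_ideal q r m n p +>\<^bsub>R_poly_ring m\<^esub> f) = ev f) \<and>
    h ` carrier RR = ev ` PP"
proof -
  interpret P: cring "mpoly_ring V :: (var, 'k) mpoly ring" by (rule cring_mpoly_ring)
  interpret S: cring "type_ring :: 'k ratfun ring" by (rule cring_type_ring)
  have "ev \<in> ring_hom (mpoly_ring V) type_ring"
    by (rule ring_hom_memI) (simp_all add: ev_hom mpoly_ring_def)
  then interpret h: ring_hom_ring "mpoly_ring V" type_ring ev
    by (intro ring_hom_ringI2) (simp_all add: P.ring_axioms S.ring_axioms)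
  have ideal: "R_ideal q r m n p = a_kernel (mpoly_ring V) type_ring ev"
  proof -
    have "R_ideal q r m n p \<subseteq> PP"
      using F_mem by (auto simp: R_ideal_def cgenideal_def R_relation_eq R_poly_ring_eq)
    then have "R_ideal q r m n p = {f \<in> PP. f \<in> R_ideal q r m n p}" by blast
    also have "\<dots> = {f \<in> PP. ev f = 0}" using ev_eq_0_iff by blast
    finally show ?thesis unfolding a_kernel_def' type_ring_simps .
  qed
  have RR: "RR = mpoly_ring V Quot a_kernel (mpoly_ring V) type_ring ev"
    unfolding R_ring_def ideal R_poly_ring_eq ..
  show "cring RR"
    unfolding RR by (intro ideal.quotient_is_cring h.kernel_is_ideal P.is_cring)
  let ?h = "\<lambda>A. the_elem (ev ` A)"
  have "?h \<in> ring_hom RR type_ring" unfolding RR by (rule h.the_elem_hom)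
  moreover have "inj_on ?h (carrier RR)"
    unfolding RR by (intro inj_onI h.the_elem_inj) simp_all
  moreover have "?h ` carrier RR = ev ` PP" unfolding RR by (rule h.the_elem_surj)
  moreover have "R_ideal q r m n p +>\<^bsub>R_poly_ring m\<^esub> f \<in> carrier RR \<and>
      ?h (R_ideal q r m n p +>\<^bsub>R_poly_ring m\<^esub> f) = ev f" if "f \<in> PP" for f
    using that unfolding ideal R_poly_ring_eq RR
    by (auto simp: FactRing_def A_RCOSETS_def')
  ultimately show "\<exists>h. h \<in> ring_hom RR type_ring \<and> inj_on h (carrier RR) \<and>
    (\<forall>f\<in>PP. R_ideal q r m n p +>\<^bsub>R_poly_ring m\<^esub> f \<in> carrier RR \<and> h (R_ideal q r m n p +>\<^bsub>R_poly_ring m\<^esub> f) = ev f) \<and>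
    h ` carrier RR = ev ` PP"
    by (intro exI[of _ ?h]) blast
qed

lemma cring_cylinder: "cring (UP RR)"
  using UP_cring.UP_cring[OF UP_cring.intro[OF cring_RR]] .

text \<open>\<open>part Y\<close> kills the image of \<open>RR\<close> and maps
  \<open>emb (mpoly_var Y)\<close> to 1, so evaluation at that element embeds the polynomial ring.
  Computations in the cylinder may then take place in \<open>adjoin gens\<close>.\<close>

lemma cylinder_embedding:
  obtains \<Phi> where "\<Phi> \<in> ring_hom (UP RR) type_ring" "inj_on \<Phi> (carrier (UP RR))"
    "\<And>c. R_cylinder_scalar q r m n p c \<in> carrier (UP RR)"
    "\<And>c. \<Phi> (R_cylinder_scalar q r m n p c) = scal c"
    "\<Phi> ` carrier (UP RR) = adjoin gens"
proof -
  interpret RR: cring RR by (rule cring_RR)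
  interpret U: UP_cring RR "UP RR" by (intro UP_cring.intro cring_RR) simp
  obtain h where h: "h \<in> ring_hom RR type_ring" "inj_on h (carrier RR)" "h ` carrier RR = ev ` PP"
    "\<And>f. f \<in> PP \<Longrightarrow> R_ideal q r m n p +>\<^bsub>R_poly_ring m\<^esub> f \<in> carrier RR"
    "\<And>f. f \<in> PP \<Longrightarrow> h (R_ideal q r m n p +>\<^bsub>R_poly_ring m\<^esub> f) = ev f"
    using RR_embedding by blast
  have "part Y (h a) = 0" if "a \<in> carrier RR" for a
    using imageI[OF that, of h] part_Y_ev unfolding h(3) by auto
  with UP_eval_into_type[OF cring_RR h(1,2) is_derivation_part, of Y "emb (mpoly_var Y)"] ratfun_of_nat_mult_eq_0
  obtain \<Phi> where \<Phi>: "\<Phi> \<in> ring_hom (UP RR) type_ring" "inj_on \<Phi> (carrier (UP RR))"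
    "\<And>a. a \<in> carrier RR \<Longrightarrow> \<Phi> (up_ring.monom (UP RR) a 0) = h a"
    "\<Phi> (up_ring.monom (UP RR) \<one>\<^bsub>RR\<^esub> 1) = emb (mpoly_var Y)"
    "\<And>f. f \<in> carrier (UP RR) \<Longrightarrow> \<exists>N c. (\<forall>j. c j \<in> carrier RR) \<and> \<Phi> f = (\<Sum>j\<le>N. h (c j) * emb (mpoly_var Y) ^ j)"
    by (simp add: part_var) blast
  have scalar: "R_scalar q r m n p c \<in> carrier RR" "h (R_scalar q r m n p c) = scal c" for c
    unfolding R_scalar_def using h(4,5)[of "mpoly_const c"] by (simp_all add: ev_def)
  have w: "emb (mpoly_var Y) \<in> adjoin gens" by (auto simp: gens_def intro: adjoin.gen)
  have "\<Phi> f \<in> adjoin gens" if f: "f \<in> carrier (UP RR)" for f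
  proof -
    obtain N c where c: "\<And>j. c j \<in> carrier RR" "\<Phi> f = (\<Sum>j\<le>N. h (c j) * emb (mpoly_var Y) ^ j)"
      using \<Phi>(5)[OF f] by blast
    have "h (c j) \<in> adjoin gens" for j
      using imageI[OF c(1), of h j] ev_mem unfolding h(3) by auto
    then show ?thesis unfolding c(2) by (intro adjoin.sum_mem adjoin.mems w)
  qed
  moreover have "adjoin gens \<subseteq> \<Phi> ` carrier (UP RR)"
  proof -
    interpret im: type_subring "\<Phi> ` carrier (UP RR)"
      by (rule type_subring_hom_image[OF cring_cylinder \<Phi>(1) U.P.carrier_is_subring])
    have const: "ev f \<in> \<Phi> ` carrier (UP RR)" if "f \<in> PP" for f
      using \<Phi>(3)[OF h(4)[OF that]] h(5)[OF that] U.monom_closed[OF h(4)[OF that], of 0] by (metis image_eqI)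
    have var: "v \<in> V \<Longrightarrow> ev (mpoly_var v) \<in> \<Phi> ` carrier (UP RR)" for v
      by (intro const var_mem_mpoly_ring)
    have "scal c \<in> \<Phi> ` carrier (UP RR)" for c
      using const[of "mpoly_const c"] by (simp add: ev_def)
    moreover have "emb (mpoly_var Y) \<in> \<Phi> ` carrier (UP RR)"
      using \<Phi>(4) U.monom_closed[OF RR.one_closed, of 1] by (metis image_eqI)
    ultimately have "gens \<subseteq> \<Phi> ` carrier (UP RR)"
      using var[of Y] var[of Z] var[of T] var[of "X i" for i] by (auto simp: gens_def V_def ev_def)
    then show ?thesis by (rule im.adjoin_subset)
  qed
  ultimately have "\<Phi> ` carrier (UP RR) = adjoin gens" by blast
  moreover have "R_cylinder_scalar q r m n p c \<in> carrier (UP RR)" "\<Phi> (R_cylinder_scalar q r m n p c) = scal c" for c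
    unfolding R_cylinder_scalar_def using scalar \<Phi>(3) U.monom_closed by auto
  ultimately show thesis using that \<Phi>(1,2) by blast
qed

end

section \<open>Derivations of the cylinder\<close>

lemma part_add: "part v (f + g) = part v f + part v g"
  and part_mult: "part v (f * g) = part v f * g + f * part v g"
  and part_minus: "part v (- f) = - part v f"
  and part_power: "part v (f ^ j) = of_nat j * f ^ (j - 1) * part v f"
  by (rule derivation_add derivation_mult derivation_minus derivation_power is_derivation_part)+

lemma emb_poly: "emb (poly (map_poly mpoly_const p) f) = poly (map_poly scal p) (emb f)"
proof (induction p)
  case (pCons c p)
  then show ?case
    by (simp add: map_poly_pCons scal.hom_zero mpoly_const_def[of 0] emb_add emb_mult) (simp add: scal_def)
qed simp

lemma euler_eigenvector_mult:
  assumes "mpoly_var v * mpoly_pderiv v f = of_nat j * f" "mpoly_var v * mpoly_pderiv v g = of_nat k * g"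
  shows "mpoly_var v * mpoly_pderiv v (f * g) = of_nat (j + k) * (f * g)"
proof -
  have "mpoly_var v * mpoly_pderiv v (f * g) =
      mpoly_var v * mpoly_pderiv v f * g + f * (mpoly_var v * mpoly_pderiv v g)"
    by (simp add: mpoly_pderiv_mult algebra_simps)
  then show ?thesis unfolding assms by (simp add: algebra_simps)
qed

context cylinder_ring
begin

definition P0 :: "(var, 'k) mpoly" where
  "P0 = mpoly_var (X 0) * poly (map_poly mpoly_const p) (\<Prod>i\<le>m. mpoly_var (X i))"

abbreviation "XX \<equiv> carrier (mpoly_ring (X ` {..m})) :: (var, 'k) mpoly set"

lemma G0_eq: "G0 = mpoly_var Z ^ q + mpoly_var T ^ r + P0"
  by (simp add: G0_def P0_def)

lemma XX_mem: "P0 \<in> XX" "M \<in> XX"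
proof -
  interpret XX: type_subring XX by (rule mpoly_ring_subring)
  show "P0 \<in> XX" "M \<in> XX"
    unfolding P0_def M_def
    by (intro XX.mems XX.poly_mem XX.prod_mem var_mem_mpoly_ring; simp add: mpoly_const_def[of 0])+
qed

lemma emb_M_nonzero: "emb M \<noteq> 0"
  using M_nonzero by simp

lemma emb_M_yv: "emb M * yv = - emb G0"
  using emb_M_nonzero by (simp add: yv_def)

lemma gens_mem: "i \<le> m \<Longrightarrow> emb (mpoly_var (X i)) \<in> adjoin gens" "yv \<in> adjoin gens"
  "emb (mpoly_var Z) \<in> adjoin gens" "emb (mpoly_var T) \<in> adjoin gens" "emb (mpoly_var Y) \<in> adjoin gens"
  "scal c \<in> adjoin gens"
  by (auto simp: gens_def intro: adjoin.gen)

lemma emb_M_mem: "emb M \<in> adjoin gens"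
  using ev_mem[of M] ev_PP' M_mem PP'_subset by auto

text \<open>Those derivations of the field that pull back to locally nilpotent
  \<open>k\<close>-derivations of the cylinder.\<close>

definition admissible :: "('k ratfun \<Rightarrow> 'k ratfun) \<Rightarrow> bool" where
  "admissible D \<longleftrightarrow> is_derivation D \<and> (\<forall>c. D (scal c) = 0) \<and>
     (\<forall>b\<in>adjoin gens. D b \<in> adjoin gens \<and> nilpotent_at D b)"

lemma admissibleI:
  assumes D: "is_derivation D" and c: "\<And>c. D (scal c) = 0"
    and g: "\<And>b. b \<in> gens \<Longrightarrow> D b \<in> adjoin gens" "\<And>b. b \<in> gens \<Longrightarrow> nilpotent_at D b"
  shows "admissible D"
proof -
  interpret nil: type_subring "{f. nilpotent_at D f}" by (rule nilpotent_at_subring[OF D])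
  have "adjoin gens \<subseteq> {f. nilpotent_at D f}"
    using g by (intro nil.adjoin_subset) blast
  moreover have "D b \<in> adjoin gens" if "b \<in> adjoin gens" for b
    using that by (rule derivation_adjoin_mem[OF D adjoin.type_subring_axioms, rotated 2]) (auto intro: adjoin.gen g)
  ultimately show ?thesis using D c by (auto simp: admissible_def)
qed

lemma nilpotent_if_killed: "D f = 0 \<Longrightarrow> nilpotent_at D f"
  using nilpotent_at_step[of D f] by (simp add: nilpotent_at_0)

lemma admissible_part_Y: "admissible (part Y)"
proof (rule admissibleI)
  have vals: "part Y b = 0 \<or> part Y b = 1" if "b \<in> gens" for b
    using that by (auto simp: gens_def part_Y_yv part_var)
  then show "part Y b \<in> adjoin gens" if "b \<in> gens" for b using that by (metis adjoin.zero_mem adjoin.one_mem)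
  show "nilpotent_at (part Y) b" if "b \<in> gens" for b
    using vals[OF that] nilpotent_at_step[of "part Y" b] nilpotent_if_killed[of "part Y" 1] by (auto simp: nilpotent_at_0)
qed simp_all

text \<open>Differentiate \<open>emb M * yv = - emb G0\<close>, where \<open>M\<close> and
  \<open>P0\<close> are free of \<open>v\<close>. The pair \<open>(v, e)\<close> treats
  \<open>z\<close> and \<open>t\<close> at once.\<close>

lemma part_v_yv:
  assumes "(v, e) \<in> {(Z, q), (T, r)}"
  shows "emb M * part v yv = - (of_nat e * emb (mpoly_var v) ^ (e - 1))"
proof -
  have "v \<notin> X ` {..m}" using assms by auto
  then have M0: "part v (emb M) = 0" and P0: "part v (emb P0) = 0"
    using part_other[OF XX_mem(2)] part_other[OF XX_mem(1)] by auto
  have "part v (emb M * yv) = - part v (emb G0)"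
    unfolding emb_M_yv by (rule part_minus)
  also have "part v (emb G0) = of_nat e * emb (mpoly_var v) ^ (e - 1)"
    using assms P0 by (auto simp: G0_eq emb_add emb_power part_add part_power part_var)
  finally show ?thesis by (simp add: part_mult M0)
qed

text \<open>Triangular: \<open>v\<close> goes to \<open>M\<close>, \<open>M\<close> to 0, and
  \<open>yv\<close> to a polynomial in \<open>v\<close>, the factor \<open>M\<close> removing its
  denominator.\<close>

lemma admissible_part_ZT:
  assumes ve: "(v, e) \<in> {(Z, q), (T, r)}"
  shows "admissible (\<lambda>f. emb M * part v f)"
proof (rule admissibleI)
  let ?D = "\<lambda>f. emb M * part v f"
  show D: "is_derivation ?D" by (intro is_derivation_scale is_derivation_part)
  interpret nil: type_subring "{f. nilpotent_at ?D f}" by (rule nilpotent_at_subring[OF D])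
  have v: "v = Z \<or> v = T" using ve by auto
  then have DM: "?D (emb M) = 0" using part_other[OF XX_mem(2), of v] by auto
  have vmem: "emb (mpoly_var v) \<in> adjoin gens" using v gens_mem by auto
  have vals: "b = yv \<or> ?D b = 0 \<or> b = emb (mpoly_var v) \<and> ?D b = emb M" if "b \<in> gens" for b
    using that v by (auto simp: gens_def part_var)
  have nil_v: "emb (mpoly_var v) \<in> {f. nilpotent_at ?D f}"
    using nilpotent_at_step[of ?D "emb (mpoly_var v)"] nilpotent_if_killed[of ?D "emb M"] DM by (simp add: part_var)
  have "?D yv \<in> {f. nilpotent_at ?D f}"
    unfolding part_v_yv[OF ve] by (intro nil.mems nil.of_nat_mem nil_v)
  then have nil_y: "nilpotent_at ?D yv" using nilpotent_at_step[of ?D yv] by simp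
  show "?D (scal c) = 0" for c by simp
  have "?D yv \<in> adjoin gens"
    unfolding part_v_yv[OF ve] by (intro adjoin.mems adjoin.of_nat_mem vmem)
  then show "?D b \<in> adjoin gens" if "b \<in> gens" for b
    using vals[OF that] emb_M_mem adjoin.zero_mem[of gens] by auto
  show "nilpotent_at ?D b" if "b \<in> gens" for b
    using vals[OF that] nil_y nil_v nilpotent_if_killed[of ?D b] by auto
qed

lemma admissible_moving_X:
  assumes p0: "poly p 0 \<noteq> 0" and i: "i \<le> m"
  shows "\<exists>E. admissible E \<and> E (emb (mpoly_var (X i))) \<noteq> 0 \<and>
    (\<forall>f. part Z f = 0 \<longrightarrow> part Y f = 0 \<longrightarrow> E f = E (emb (mpoly_var (X i))) * part (X i) f)"
proof -
  define xs where "xs j = emb (mpoly_var (X j) :: (var, 'k) mpoly)" for j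
  define z where "z = emb (mpoly_var Z :: (var, 'k) mpoly)"
  define t where "t = emb (mpoly_var T :: (var, 'k) mpoly)"
  define s where "s = emb (mpoly_var Y :: (var, 'k) mpoly)"
  define J where "J = {..m} - {i}"
  define K where "K = range scal \<union> xs ` J \<union> {t}"
  define u where "u = (\<Prod>j\<in>J. xs j ^ n j)"
  obtain c0 p1 where p: "p = pCons c0 p1" by (cases p)
  have c0: "c0 \<noteq> 0" using p0 by (simp add: p)
  \<comment> \<open>Splits \<open>t ^ r + xs 0 * p(w)\<close> as \<open>a + xs i * b\<close> with
    \<open>a\<close> free of \<open>xs i\<close>. For \<open>i = 0\<close> the whole second summand
    goes into \<open>b\<close>; otherwise \<open>xs i\<close> divides \<open>w\<close>, and only the
    constant term \<open>c0\<close> of \<open>p\<close> contributes to \<open>a\<close>.\<close>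
  define a where "a = (if i = 0 then t ^ r else t ^ r + xs 0 * scal c0)"
  define w where "w = (\<Prod>j\<le>m. xs j)"
  define b where "b = (if i = 0 then poly (map_poly scal p) w
    else xs 0 * (\<Prod>j\<in>J. xs j) * poly (map_poly scal p1) w)"
  have part_xs: "part v (xs j) = (if v = X j then 1 else 0)" for v j
    by (simp add: xs_def part_var)
  have part_zts: "part v z = (if v = Z then 1 else 0)" "part v t = (if v = T then 1 else 0)"
    "part v s = (if v = Y then 1 else 0)" for v
    by (simp_all add: z_def t_def s_def part_var)
  have w: "w = xs i * (\<Prod>j\<in>J. xs j)"
    unfolding w_def J_def using i by (simp add: prod.remove)
  have M: "emb M = xs i ^ n i * u"
    unfolding M_def emb_prod emb_power xs_def[symmetric] u_def J_def using i by (simp add: prod.remove)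
  have G0: "emb G0 = z ^ q + t ^ r + xs 0 * poly (map_poly scal p) w"
    by (simp add: G0_def emb_add emb_mult emb_power emb_poly emb_prod z_def t_def xs_def w_def)
  have ab: "a + xs i * b = t ^ r + xs 0 * poly (map_poly scal p) w"
    by (simp add: a_def b_def p map_poly_pCons scal.hom_zero w algebra_simps)
  have a_nz: "a \<noteq> 0"
  proof
    assume a0: "a = 0"
    show False
    proof (cases "i = 0")
      case True
      then show False using a0 by (simp add: a_def t_def)
    next
      case False
      then have "part (X 0) a = scal c0"
        by (simp add: a_def part_add part_mult part_power part_xs part_zts)
      then have "scal c0 = 0" using a0 by (simp add: derivation_0)
      then show False using c0 by (simp add: scal_def mpoly_const_def) (metis lookup_single_eq lookup_zero)
    qed
  qed
  have K_mem: "xs j \<in> adjoin K" if "j \<in> J" for j using that by (auto simp: K_def intro: adjoin.gen)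
  have tK: "t \<in> adjoin K" "scal c \<in> adjoin K" for c by (auto simp: K_def intro: adjoin.gen)
  have xK: "xs j \<in> adjoin (insert (xs i) K)" if "j \<le> m" for j
    using that by (auto simp: K_def J_def intro: adjoin.gen)
  have sK: "scal c \<in> adjoin (insert (xs i) K)" for c by (auto simp: K_def intro: adjoin.gen)
  have K_kill: "part (X i) c = 0" "part Z c = 0" "part Y c = 0" if "c \<in> K" for c
    using that by (auto simp: K_def part_xs part_zts J_def split: if_splits)
  interpret chart: cylinder_chart K "xs i" yv z s a u b q "n i" "part (X i)" "part Z" "part Y"
  proof
    show "a \<in> adjoin K"
      unfolding a_def using i by (auto simp: J_def intro!: adjoin.mems tK K_mem)
    show "u \<in> adjoin K"
      unfolding u_def by (intro adjoin.prod_mem adjoin.mems K_mem)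
    have w_mem: "w \<in> adjoin (insert (xs i) K)"
      unfolding w_def by (intro adjoin.prod_mem xK) simp
    have poly_mem: "poly (map_poly scal p') w \<in> adjoin (insert (xs i) K)" for p'
      by (intro adjoin.poly_mem scal.hom_zero sK w_mem)
    have "(\<Prod>j\<in>J. xs j) \<in> adjoin (insert (xs i) K)"
      unfolding J_def by (intro adjoin.prod_mem xK) simp
    then show "b \<in> adjoin (insert (xs i) K)"
      using poly_mem[of p] poly_mem[of p1] xK[of 0] by (auto simp: b_def intro: adjoin.mult_mem)
    show "inverse (of_nat q) \<in> K"
      unfolding K_def scal_of_nat[symmetric] scal_inverse[symmetric] by simp
    show "u \<noteq> 0" by (simp add: u_def xs_def J_def)
    show "xs i \<noteq> 0" by (simp add: xs_def)
    obtain q' where "q = Suc q'" using qr by (cases q) auto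
    then show "of_nat q \<noteq> (0::'k ratfun)" using ratfun_of_nat_mult_eq_0[of q' "1::'k ratfun"] by auto
    have "u * xs i ^ n i * yv + z ^ q + a + xs i * b = emb M * yv + (z ^ q + (a + xs i * b))"
      by (simp add: M algebra_simps)
    then show "u * xs i ^ n i * yv + z ^ q + a + xs i * b = 0"
      unfolding ab emb_M_yv G0 by simp
  qed (use a_nz n[OF i] K_kill in \<open>auto simp: part_xs part_zts\<close>)
  have "part Z chart.z1 = 1"
    by (simp add: chart.z1_def part_add part_mult part_xs part_zts)
  then have "chart.z1 \<noteq> 0" by auto
  then obtain E where E: "is_derivation E" "\<And>c. c \<in> K \<Longrightarrow> E c = 0" "\<And>f. f \<in> chart.B \<Longrightarrow> E f \<in> chart.B"
    "\<And>f. f \<in> chart.B \<Longrightarrow> nilpotent_at E f" "E (xs i) \<noteq> 0"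
    "\<And>f. part Z f = 0 \<Longrightarrow> part Y f = 0 \<Longrightarrow> E f = E (xs i) * part (X i) f"
    by (rule chart.derivation_moving_x) blast
  have "K \<union> {xs i, yv, z, s} = gens"
    unfolding K_def gens_def J_def xs_def z_def t_def s_def using i by auto
  then have "chart.B = adjoin gens" unfolding chart.B_def by simp
  with E have "admissible E" by (auto simp: admissible_def K_def)
  with E(5,6) show ?thesis unfolding xs_def by blast
qed

text \<open>The only generator with a denominator is \<open>yv\<close>, and \<open>M\<close> clears
  it. In \<open>g\<close> the variable \<open>Y\<close> is the cylinder coordinate, not the
  \<open>y\<close> of the relation.\<close>

lemma clear_denominators:
  assumes "f \<in> adjoin gens"
  shows "\<exists>N. \<exists>g\<in>PP. emb M ^ N * f = emb g"
proof -
  have MP: "M \<in> PP" "G0 \<in> PP" using M_mem G0_mem PP'_subset by auto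
  interpret S: type_subring "{f. \<exists>N. \<exists>g\<in>PP. emb M ^ N * f = emb g}"
  proof
    show "1 \<in> {f. \<exists>N. \<exists>g\<in>PP. emb M ^ N * f = emb g}"
      by (auto intro!: exI[of _ 0] bexI[of _ 1])
    fix f assume "f \<in> {f. \<exists>N. \<exists>g\<in>PP. emb M ^ N * f = emb g}"
    then obtain N g where f: "g \<in> PP" "emb M ^ N * f = emb g" by blast
    have "emb M ^ N * - f = emb (- g)" using f by (simp add: emb_minus)
    then show "- f \<in> {f. \<exists>N. \<exists>g\<in>PP. emb M ^ N * f = emb g}" using P.uminus_mem[OF f(1)] by blast
    fix f' assume "f' \<in> {f. \<exists>N. \<exists>g\<in>PP. emb M ^ N * f = emb g}"
    then obtain N' g' where f': "g' \<in> PP" "emb M ^ N' * f' = emb g'" by blast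
    have "emb M ^ (N + N') * (f + f') = emb M ^ N' * (emb M ^ N * f) + emb M ^ N * (emb M ^ N' * f')"
      by (simp add: power_add algebra_simps)
    also have "\<dots> = emb (M ^ N' * g + M ^ N * g')"
      unfolding f f' by (simp add: emb_add emb_mult emb_power)
    finally have "emb M ^ (N + N') * (f + f') = emb (M ^ N' * g + M ^ N * g')" .
    moreover have "M ^ N' * g + M ^ N * g' \<in> PP" by (intro P.mems MP f f')
    ultimately show "f + f' \<in> {f. \<exists>N. \<exists>g\<in>PP. emb M ^ N * f = emb g}" by blast
    have "emb M ^ (N + N') * (f * f') = (emb M ^ N * f) * (emb M ^ N' * f')"
      by (simp add: power_add algebra_simps)
    also have "\<dots> = emb (g * g')"
      unfolding f f' by (simp add: emb_mult)
    finally show "f * f' \<in> {f. \<exists>N. \<exists>g\<in>PP. emb M ^ N * f = emb g}"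
      using P.mult_mem[OF f(1) f'(1)] by blast
  qed
  have base: "\<exists>N. \<exists>g\<in>PP. emb M ^ N * emb f = emb g" if "f \<in> PP" for f
    using that by (intro exI[of _ 0]) auto
  have "emb M ^ 1 * yv = emb (- G0)" using emb_M_yv by (simp add: emb_minus)
  then have "\<exists>N. \<exists>g\<in>PP. emb M ^ N * yv = emb g" using P.uminus_mem[OF MP(2)] by blast
  moreover have "\<exists>N. \<exists>g\<in>PP. emb M ^ N * emb (mpoly_var v) = emb g" if "v \<in> V" for v
    using that by (intro base var_mem_mpoly_ring)
  moreover have "X i \<in> V" "Y \<in> V" "Z \<in> V" "T \<in> V" if "i \<le> m" for i
    using that by (auto simp: V_def)
  moreover have "\<exists>N. \<exists>g\<in>PP. emb M ^ N * scal c = emb g" for c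
    unfolding scal_def by (intro base const_mem_mpoly_ring)
  ultimately have "gens \<subseteq> {f. \<exists>N. \<exists>g\<in>PP. emb M ^ N * f = emb g}"
    unfolding gens_def by blast
  then show ?thesis using S.adjoin_subset assms by blast
qed

text \<open>Variables are Euler eigenvectors, and eigenvalues add under products.\<close>

lemma M_power_eigenvector:
  "\<exists>w. \<forall>v. mpoly_var v * mpoly_pderiv v (M ^ N) = of_nat (w v) * M ^ N"
proof -
  define eig where "eig = {f :: (var, 'k) mpoly. \<exists>w. \<forall>v. mpoly_var v * mpoly_pderiv v f = of_nat (w v) * f}"
  have eig_1: "1 \<in> eig"
    by (auto simp: eig_def is_derivation_mpoly_pderiv intro: exI[of _ "\<lambda>_. 0"])
  have eig_mult: "f * g \<in> eig" if "f \<in> eig" "g \<in> eig" for f g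
  proof -
    from that obtain w w' where "\<forall>v. mpoly_var v * mpoly_pderiv v f = of_nat (w v) * f"
      "\<forall>v. mpoly_var v * mpoly_pderiv v g = of_nat (w' v) * g"
      unfolding eig_def by blast
    then have "\<forall>v. mpoly_var v * mpoly_pderiv v (f * g) = of_nat (w v + w' v) * (f * g)"
      by (intro allI euler_eigenvector_mult) blast+
    then show ?thesis unfolding eig_def by (intro CollectI exI[of _ "\<lambda>v. w v + w' v"])
  qed
  have eig_power: "f ^ j \<in> eig" if "f \<in> eig" for f j
    by (induction j) (use that in \<open>auto intro: eig_1 eig_mult\<close>)
  have "mpoly_var v \<in> eig" for v
    unfolding eig_def by (auto simp: mpoly_pderiv_var intro!: exI[of _ "\<lambda>v'. if v' = v then 1 else 0"])
  then have "(\<Prod>i\<in>A. mpoly_var (X i) ^ n i) \<in> eig" for A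
    by (induction A rule: infinite_finite_induct) (auto intro: eig_1 eig_mult eig_power)
  then have "M ^ N \<in> eig" unfolding M_def by (intro eig_power)
  then show ?thesis unfolding eig_def by blast
qed

text \<open>With all partial derivatives of \<open>f\<close> zero, \<open>g = M ^ N * f\<close> has
  the same Euler eigenvalues as \<open>M ^ N\<close>, hence is a constant multiple of it.\<close>

lemma scalar_if_partials_vanish:
  assumes f: "f \<in> adjoin gens" and part: "\<And>v. v \<in> V \<Longrightarrow> part v f = 0"
  shows "f \<in> range scal"
proof -
  obtain N g where g: "g \<in> PP" "emb M ^ N * f = emb g" using clear_denominators[OF f] by blast
  obtain w where w: "\<And>v. mpoly_var v * mpoly_pderiv v (M ^ N) = of_nat (w v) * M ^ N"
    using M_power_eigenvector by blast
  have MN: "M ^ N \<in> PP" using M_mem PP'_subset by (intro P.power_mem) auto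
  have "mpoly_var v * mpoly_pderiv v g = of_nat (w v) * g" if "v \<in> V" for v
  proof -
    have "emb (mpoly_pderiv v g) = part v (emb (M ^ N) * f)"
      by (simp add: part_emb[symmetric] emb_power g)
    also have "\<dots> = emb (mpoly_pderiv v (M ^ N)) * f"
      using part[OF that] by (simp add: part_mult part_emb)
    finally have "emb (mpoly_var v * mpoly_pderiv v g) = emb (mpoly_var v * mpoly_pderiv v (M ^ N)) * f"
      by (simp add: emb_mult)
    also have "\<dots> = emb (of_nat (w v)) * (emb M ^ N * f)"
      unfolding w by (simp add: emb_mult emb_power)
    also have "\<dots> = emb (of_nat (w v) * g)"
      unfolding g by (simp add: emb_mult)
    finally show ?thesis by simp
  qed
  then obtain c where "g = mpoly_const c * M ^ N"
    using proportional_if_euler_eigenvectors[OF g(1) MN, of w] w M_nonzero by auto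
  then have "emb M ^ N * f = emb M ^ N * scal c"
    using g(2) by (simp add: emb_mult emb_power scal_def)
  then have "f = scal c" using emb_M_nonzero by simp
  then show ?thesis by simp
qed

section \<open>The Makar-Limanov and Derksen invariants of the cylinder\<close>

theorem invariants_of_cylinder:
  assumes p0: "poly p 0 \<noteq> 0"
  shows "makar_limanov (R_cylinder_scalar q r m n p) (UP RR) = range (R_cylinder_scalar q r m n p)"
    and "derksen (R_cylinder_scalar q r m n p) (UP RR) = carrier (UP RR)"
proof -
  let ?\<phi> = "R_cylinder_scalar q r m n p" and ?A = "UP RR"
  interpret A: cring ?A by (rule cring_cylinder)
  obtain \<Phi> where \<Phi>: "\<Phi> \<in> ring_hom ?A type_ring" "inj_on \<Phi> (carrier ?A)"
    "\<And>c. ?\<phi> c \<in> carrier ?A" "\<And>c. \<Phi> (?\<phi> c) = scal c" "\<Phi> ` carrier ?A = adjoin gens"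
    by (rule cylinder_embedding) blast
  note zero = hom_type_ring_zero[OF cring_cylinder \<Phi>(1)]
  have \<Phi>_mem: "\<Phi> f \<in> adjoin gens" if "f \<in> carrier ?A" for f using that \<Phi>(5) by blast
  have pull: "\<exists>D'. locally_nilpotent_derivation ?\<phi> ?A D' \<and> (\<forall>b\<in>carrier ?A. \<Phi> (D' b) = D (\<Phi> b))"
    if "admissible D" for D
  proof -
    have "is_derivation D" "\<And>c. D (\<Phi> (?\<phi> c)) = 0"
      "\<And>b. b \<in> carrier ?A \<Longrightarrow> D (\<Phi> b) \<in> \<Phi> ` carrier ?A"
      "\<And>b. b \<in> carrier ?A \<Longrightarrow> nilpotent_at D (\<Phi> b)"
      using that \<Phi>_mem unfolding admissible_def \<Phi>(4,5) by blast+
    then show ?thesis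
      using locally_nilpotent_derivation_pullback[OF cring_cylinder \<Phi>(1,2), of ?\<phi> D] \<Phi>(3) by metis
  qed

  show "makar_limanov ?\<phi> ?A = range ?\<phi>"
  proof
    show "range ?\<phi> \<subseteq> makar_limanov ?\<phi> ?A"
      using derivation_over_scalar[OF cring_cylinder, of ?\<phi>] \<Phi>(3)
      by (auto simp: makar_limanov_def locally_nilpotent_derivation_def a_kernel_def')
    show "makar_limanov ?\<phi> ?A \<subseteq> range ?\<phi>"
    proof
      fix f assume f: "f \<in> makar_limanov ?\<phi> ?A"
      have kill: "f \<in> carrier ?A \<and> D (\<Phi> f) = 0" if D: "admissible D" for D
      proof -
        from pull[OF D] obtain D' where D': "locally_nilpotent_derivation ?\<phi> ?A D'"
          "\<And>b. b \<in> carrier ?A \<Longrightarrow> \<Phi> (D' b) = D (\<Phi> b)" by blast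
        with f have "f \<in> carrier ?A" "D' f = \<zero>\<^bsub>?A\<^esub>" by (auto simp: makar_limanov_def a_kernel_def')
        with D'(2)[of f] zero show ?thesis by simp
      qed
      have fA: "f \<in> carrier ?A" and pY: "part Y (\<Phi> f) = 0" using kill[OF admissible_part_Y] by auto
      have pZ: "part Z (\<Phi> f) = 0" and pT: "part T (\<Phi> f) = 0"
        using kill[OF admissible_part_ZT[of Z q]] kill[OF admissible_part_ZT[of T r]] M_nonzero by auto
      \<comment> \<open>Since the partial derivatives in \<open>Z\<close> and \<open>Y\<close>
        already vanish, \<open>E\<close> acts on \<open>\<Phi> f\<close> as a nonzero multiple of
        \<open>part (X i)\<close>.\<close>
      have pX: "part (X i) (\<Phi> f) = 0" if i: "i \<le> m" for i
      proof -
        obtain E where E: "admissible E" "E (emb (mpoly_var (X i))) \<noteq> 0"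
          "\<And>f. part Z f = 0 \<Longrightarrow> part Y f = 0 \<Longrightarrow> E f = E (emb (mpoly_var (X i))) * part (X i) f"
          using admissible_moving_X[OF p0 i] by blast
        then show ?thesis using kill[OF E(1)] pZ pY by simp
      qed
      have "part v (\<Phi> f) = 0" if "v \<in> V" for v
        using that pX pY pZ pT by (auto simp: V_def)
      then obtain c where "\<Phi> f = scal c"
        using scalar_if_partials_vanish[OF \<Phi>_mem[OF fA]] by blast
      then have "f = ?\<phi> c" by (intro inj_onD[OF \<Phi>(2) _ fA \<Phi>(3)]) (simp add: \<Phi>(4))
      then show "f \<in> range ?\<phi>" by simp
    qed
  qed

  \<comment> \<open>The set that generates the Derksen invariant; it suffices to find every element
    of \<open>gens\<close> in its image.\<close>
  define S where "S = range ?\<phi> \<union>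
    (\<Union>D \<in> {D. locally_nilpotent_derivation ?\<phi> ?A D \<and> (\<exists>b\<in>carrier ?A. D b \<noteq> \<zero>\<^bsub>?A\<^esub>)}. a_kernel ?A ?A D)"
  have S: "S \<subseteq> carrier ?A" using \<Phi>(3) by (auto simp: S_def a_kernel_def')
  \<comment> \<open>The element \<open>g\<close> certifies that the pulled back derivation is
    nonzero.\<close>
  have killed_mem: "f \<in> S"
    if D: "admissible D" and nz: "g \<in> adjoin gens" "D g \<noteq> 0" and f: "f \<in> carrier ?A" "D (\<Phi> f) = 0" for D f g
  proof -
    from pull[OF D] obtain D' where D': "locally_nilpotent_derivation ?\<phi> ?A D'"
      "\<And>b. b \<in> carrier ?A \<Longrightarrow> \<Phi> (D' b) = D (\<Phi> b)" by blast
    have "D' \<in> carrier ?A \<rightarrow> carrier ?A"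
      using D'(1) unfolding locally_nilpotent_derivation_def derivation_over_def by (elim conjE)
    then have closed: "D' b \<in> carrier ?A" if "b \<in> carrier ?A" for b
      using that by (rule funcset_mem)
    have "g \<in> \<Phi> ` carrier ?A" unfolding \<Phi>(5) by (rule nz(1))
    then obtain b where b: "b \<in> carrier ?A" "\<Phi> b = g" by blast
    have "\<Phi> (D' b) \<noteq> \<Phi> \<zero>\<^bsub>?A\<^esub>" unfolding D'(2)[OF b(1)] b(2) zero by (rule nz(2))
    then have "D' b \<noteq> \<zero>\<^bsub>?A\<^esub>" by (rule contrapos_nn) (simp only:)
    moreover have "D' f = \<zero>\<^bsub>?A\<^esub>"
    proof (rule inj_onD[OF \<Phi>(2)])
      show "\<Phi> (D' f) = \<Phi> \<zero>\<^bsub>?A\<^esub>" unfolding D'(2)[OF f(1)] f(2) zero ..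
    qed (use closed[OF f(1)] in simp_all)
    ultimately show ?thesis using D'(1) b(1) f(1) unfolding S_def a_kernel_def' by blast
  qed
  have sub: "subring (generate_ring ?A S) ?A" using S by (rule A.generate_ring_is_subring)
  interpret im: type_subring "\<Phi> ` generate_ring ?A S"
    using cring_cylinder \<Phi>(1) sub by (rule type_subring_hom_image)
  have "g \<in> \<Phi> ` generate_ring ?A S" if g: "g \<in> gens" for g
  proof -
    have "g \<in> \<Phi> ` carrier ?A" unfolding \<Phi>(5) using g by (rule adjoin.gen)
    then obtain f where f: "f \<in> carrier ?A" "\<Phi> f = g" by blast
    have "f \<in> S"
    \<comment> \<open>The cylinder coordinate is killed by \<open>M\<close> times
      \<open>part Z\<close>, every other generator by \<open>part Y\<close>; both derivations are
      nonzero.\<close>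
    proof (cases "g = emb (mpoly_var Y)")
      case True
      show ?thesis
        using admissible_part_ZT[of Z q] gens_mem(3) f True emb_M_nonzero
        by (intro killed_mem[of "\<lambda>f. emb M * part Z f" "emb (mpoly_var Z)"]) (auto simp: part_var)
    next
      case False
      then have "part Y g = 0" using g by (auto simp: gens_def part_Y_yv part_var)
      then show ?thesis
        using admissible_part_Y gens_mem(5) f
        by (intro killed_mem[of "part Y" "emb (mpoly_var Y)"]) (auto simp: part_var)
    qed
    then show ?thesis using f by (auto intro: generate_ring.incl)
  qed
  then have "adjoin gens \<subseteq> \<Phi> ` generate_ring ?A S" by (intro im.adjoin_subset) blast
  then have "carrier ?A \<subseteq> generate_ring ?A S"
    using \<Phi>_mem inj_on_image_mem_iff[OF \<Phi>(2) _ A.generate_ring_incl[OF S]] by blast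
  then show "derksen ?\<phi> ?A = carrier ?A"
    using A.generate_ring_incl[OF S] unfolding derksen_def S_def by blast
qed

end

theorem proposition4:
  fixes q r m :: nat and n :: "nat \<Rightarrow> nat" and p :: "'k::field_char_0 poly"
  assumes "q \<ge> 2" and "r \<ge> 2" and "gcd q r = 1"
    and "\<And>i. i \<le> m \<Longrightarrow> n i > 1"
    and "poly p 0 \<noteq> 0"
  shows "makar_limanov (R_cylinder_scalar q r m n p) (UP (R_ring q r m n p))
           = R_cylinder_scalar q r m n p ` UNIV
       \<and> derksen (R_cylinder_scalar q r m n p) (UP (R_ring q r m n p))
           = carrier (UP (R_ring q r m n p))"
proof -
  interpret cylinder_ring q r m n p
  proof
    show "n i \<ge> 1" if "i \<le> m" for i using assms(4)[OF that] by simp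
  qed (use assms in auto)
  show ?thesis using invariants_of_cylinder[OF assms(5)] by blast
qed

end
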